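(* Let $g\in H(\mathbb{D})$ be such that $J_g$ is bounded on the Bloch space $\mathcal{B}$. Then $C_\varphi J_g-J_gC_\varphi:\mathcal{B}\to\mathcal{B}$ is compact for every $\varphi\in S(\mathbb{D})$ if and only if $$\lim_{|z|\to1}(1-|z|^2)\,|g'(z)|\log\frac{2}{1-|z|^2}=0.$$
   Context: $\mathbb{D}$ is the open unit disk in $\mathbb{C}$, $H(\mathbb{D})$ is the set of holomorphic functions on $\mathbb{D}$, and $S(\mathbb{D})$ is the set of holomorphic maps $\mathbb{D}\to\mathbb{D}$. For $\varphi\in S(\mathbb{D})$, $C_\varphi f=f\circ\varphi$. For $g,f\in H(\mathbb{D})$, $J_gf(z)=\int_0^z f(\zeta)g'(\zeta)\,d\zeta$. The Bloch space $\mathcal{B}$ is the set of $f\in H(\mathbb{D})$ with $\|f\|_*=\sup_{z\in\mathbb{D}}(1-|z|^2)|f'(z)|<\infty$, a Banach space with norm $|f(0)|+\|f\|_*$. *)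

theory Defs
  imports "HOL-Complex_Analysis.Complex_Analysis"
begin

abbreviation unit_disk :: "complex set" ("\<bbbD>")
  where "\<bbbD> \<equiv> ball 0 1"

definition disk_selfmaps :: "(complex \<Rightarrow> complex) set"
  where "disk_selfmaps = {\<phi>. \<phi> holomorphic_on \<bbbD> \<and> \<phi> ` \<bbbD> \<subseteq> \<bbbD>}"

definition bloch_seminorm :: "(complex \<Rightarrow> complex) \<Rightarrow> real"
  where "bloch_seminorm f = (SUP z\<in>\<bbbD>. (1 - (cmod z)\<^sup>2) * cmod (deriv f z))"

definition bloch_norm :: "(complex \<Rightarrow> complex) \<Rightarrow> real"
  where "bloch_norm f = cmod (f 0) + bloch_seminorm f"

text \<open>A function on the disk is represented by a HOL function that takes the fixed value
  \<^term>\<open>undefined\<close> off the disk, so that equality of representatives is equality on the disk and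
  \<open>bloch_norm\<close> separates points. Accordingly all operations below restrict their results
  to the disk.\<close>

definition bloch_space :: "(complex \<Rightarrow> complex) set"
  where "bloch_space = {f \<in> extensional \<bbbD>. f holomorphic_on \<bbbD> \<and>
           bdd_above ((\<lambda>z. (1 - (cmod z)\<^sup>2) * cmod (deriv f z)) ` \<bbbD>)}"

text \<open>The locale \<^locale>\<open>Metric_space\<close> asks for nonnegativity and symmetry also outside the carrier,
  where \<open>bloch_norm\<close> is meaningless; hence the value 0 there.\<close>

definition bloch_dist :: "(complex \<Rightarrow> complex) \<Rightarrow> (complex \<Rightarrow> complex) \<Rightarrow> real"
  where "bloch_dist f h =
           (if f \<in> bloch_space \<and> h \<in> bloch_space then bloch_norm (\<lambda>z\<in>\<bbbD>. f z - h z) else 0)"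

definition bloch_topology :: "(complex \<Rightarrow> complex) topology"
  where "bloch_topology = Metric_space.mtopology bloch_space bloch_dist"

definition bloch_linear :: "((complex \<Rightarrow> complex) \<Rightarrow> (complex \<Rightarrow> complex)) \<Rightarrow> bool"
  where "bloch_linear T \<longleftrightarrow> T ` bloch_space \<subseteq> bloch_space \<and>
           (\<forall>f\<in>bloch_space. \<forall>h\<in>bloch_space. \<forall>a b.
              T (\<lambda>z\<in>\<bbbD>. a * f z + b * h z) = (\<lambda>z\<in>\<bbbD>. a * T f z + b * T h z))"

definition bloch_bounded :: "((complex \<Rightarrow> complex) \<Rightarrow> (complex \<Rightarrow> complex)) \<Rightarrow> bool"
  where "bloch_bounded T \<longleftrightarrow> bloch_linear T \<and>
           (\<exists>K. \<forall>f\<in>bloch_space. bloch_norm (T f) \<le> K * bloch_norm f)"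

definition bloch_compact :: "((complex \<Rightarrow> complex) \<Rightarrow> (complex \<Rightarrow> complex)) \<Rightarrow> bool"
  where "bloch_compact T \<longleftrightarrow> bloch_linear T \<and>
           compactin bloch_topology
             (bloch_topology closure_of (T ` {f \<in> bloch_space. bloch_norm f \<le> 1}))"

definition composition_op :: "(complex \<Rightarrow> complex) \<Rightarrow> (complex \<Rightarrow> complex) \<Rightarrow> (complex \<Rightarrow> complex)"
  where "composition_op \<phi> f = (\<lambda>z\<in>\<bbbD>. f (\<phi> z))"

definition volterra_op :: "(complex \<Rightarrow> complex) \<Rightarrow> (complex \<Rightarrow> complex) \<Rightarrow> (complex \<Rightarrow> complex)"
  where "volterra_op g f =
           (\<lambda>z\<in>\<bbbD>. contour_integral (linepath 0 z) (\<lambda>\<zeta>. f \<zeta> * deriv g \<zeta>))"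

definition op_diff :: "((complex \<Rightarrow> complex) \<Rightarrow> (complex \<Rightarrow> complex)) \<Rightarrow>
    ((complex \<Rightarrow> complex) \<Rightarrow> (complex \<Rightarrow> complex)) \<Rightarrow> (complex \<Rightarrow> complex) \<Rightarrow> (complex \<Rightarrow> complex)"
  where "op_diff S T f = (\<lambda>z\<in>\<bbbD>. S f z - T f z)"

lemma deriv_restrict_disk:
  assumes "z \<in> \<bbbD>"
  shows "deriv (restrict f \<bbbD>) z = deriv f z"
proof (rule deriv_cong_ev)
  have "\<forall>\<^sub>F w in nhds z. w \<in> \<bbbD>"
    using assms by (intro eventually_nhds_in_open) auto
  then show "\<forall>\<^sub>F w in nhds z. restrict f \<bbbD> w = f w"
    by eventually_elim (simp add: restrict_def)
qed simp

lemma bloch_differentiable: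
  assumes "f \<in> bloch_space" "z \<in> \<bbbD>"
  shows "f field_differentiable at z"
  using assms unfolding bloch_space_def
  by (auto intro: holomorphic_on_imp_differentiable_at[of f \<bbbD>])

lemma deriv_bloch_diff:
  assumes "f \<in> bloch_space" "h \<in> bloch_space" "z \<in> \<bbbD>"
  shows "deriv (\<lambda>z\<in>\<bbbD>. f z - h z) z = deriv f z - deriv h z"
  using deriv_restrict_disk[OF assms(3), of "\<lambda>z. f z - h z"]
    deriv_diff[OF bloch_differentiable[OF assms(1,3)] bloch_differentiable[OF assms(2,3)]]
  by simp

lemma disk_weight_nonneg: "z \<in> \<bbbD> \<Longrightarrow> 0 \<le> 1 - (cmod z)\<^sup>2"
  by (simp add: abs_square_le_1)

lemma bloch_seminorm_bound:
  assumes "f \<in> bloch_space" "z \<in> \<bbbD>"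
  shows "(1 - (cmod z)\<^sup>2) * cmod (deriv f z) \<le> bloch_seminorm f"
  using assms unfolding bloch_space_def bloch_seminorm_def by (intro cSUP_upper) auto

lemma bloch_seminorm_nonneg:
  assumes "f \<in> bloch_space" shows "0 \<le> bloch_seminorm f"
  using order_trans[OF norm_ge_zero, of "deriv f 0"] bloch_seminorm_bound[OF assms, of 0] by simp

lemma bloch_diff_bound:
  assumes "f \<in> bloch_space" "h \<in> bloch_space" "z \<in> \<bbbD>"
  shows "(1 - (cmod z)\<^sup>2) * cmod (deriv (\<lambda>z\<in>\<bbbD>. f z - h z) z) \<le> bloch_seminorm f + bloch_seminorm h"
proof -
  have "(1 - (cmod z)\<^sup>2) * cmod (deriv f z - deriv h z)
        \<le> (1 - (cmod z)\<^sup>2) * (cmod (deriv f z) + cmod (deriv h z))"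
    using disk_weight_nonneg[OF assms(3)] by (intro mult_left_mono norm_triangle_ineq4)
  then show ?thesis
    using bloch_seminorm_bound[OF assms(1,3)] bloch_seminorm_bound[OF assms(2,3)]
    by (simp add: deriv_bloch_diff[OF assms] distrib_left)
qed

lemma bloch_space_diff:
  assumes "f \<in> bloch_space" "h \<in> bloch_space"
  shows "(\<lambda>z\<in>\<bbbD>. f z - h z) \<in> bloch_space"
proof -
  have "(\<lambda>z. f z - h z) holomorphic_on \<bbbD>"
    using assms by (auto simp: bloch_space_def intro!: holomorphic_intros)
  then have "(\<lambda>z\<in>\<bbbD>. f z - h z) holomorphic_on \<bbbD>"
    by (rule holomorphic_transform) auto
  then show ?thesis
    using bloch_diff_bound[OF assms] unfolding bloch_space_def
    by (auto intro!: bdd_aboveI2[where M = "bloch_seminorm f + bloch_seminorm h"])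
qed

lemma bloch_space_cong:
  assumes "f \<in> bloch_space" "h \<in> bloch_space" "\<And>z. z \<in> \<bbbD> \<Longrightarrow> f z = h z"
  shows "f = h"
  using assms unfolding bloch_space_def by (blast intro: extensionalityI)

lemma bloch_norm_zero_iff:
  assumes "f \<in> bloch_space"
  shows "bloch_norm f = 0 \<longleftrightarrow> (\<forall>z\<in>\<bbbD>. f z = 0)"
proof
  assume "bloch_norm f = 0"
  then have 0: "f 0 = 0" "bloch_seminorm f = 0"
    using bloch_seminorm_nonneg[OF assms] unfolding bloch_norm_def
    by (auto simp: add_nonneg_eq_0_iff)
  have "deriv f z = 0" if z: "z \<in> \<bbbD>" for z
  proof -
    have "0 < 1 - (cmod z)\<^sup>2"
      using z by (simp add: abs_square_less_1)
    then show ?thesis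
      using bloch_seminorm_bound[OF assms z] 0 by (simp add: mult_le_0_iff)
  qed
  then have "(f has_field_derivative 0) (at z within \<bbbD>)" if "z \<in> \<bbbD>" for z
    using bloch_differentiable[OF assms that] that
    by (metis DERIV_deriv_iff_field_differentiable has_field_derivative_at_within)
  then obtain c where "\<And>z. z \<in> \<bbbD> \<Longrightarrow> f z = c"
    using has_field_derivative_zero_constant[of \<bbbD> f] by auto
  with 0 show "\<forall>z\<in>\<bbbD>. f z = 0"
    by (metis centre_in_ball zero_less_one)
next
  assume R: "\<forall>z\<in>\<bbbD>. f z = 0"
  have "deriv f z = 0" if z: "z \<in> \<bbbD>" for z
  proof -
    have "deriv f z = deriv (\<lambda>_. 0) z"
      using R z by (intro complex_derivative_transform_within_open[of f \<bbbD>])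
        (use assms in \<open>auto simp: bloch_space_def\<close>)
    then show ?thesis by simp
  qed
  then show "bloch_norm f = 0"
    using R by (simp add: bloch_norm_def bloch_seminorm_def cong: SUP_cong_simp)
qed

lemma Metric_space_bloch: "Metric_space bloch_space bloch_dist"
proof
  fix f h :: "complex \<Rightarrow> complex"
  show "0 \<le> bloch_dist f h"
    using bloch_seminorm_nonneg[OF bloch_space_diff] by (simp add: bloch_dist_def bloch_norm_def)
  show "bloch_dist f h = bloch_dist h f"
    by (auto simp: bloch_dist_def bloch_norm_def bloch_seminorm_def deriv_bloch_diff
        norm_minus_commute simp del: mem_ball intro!: SUP_cong)
next
  fix f h assume fh: "f \<in> bloch_space" "h \<in> bloch_space"
  then show "bloch_dist f h = 0 \<longleftrightarrow> f = h"
    using bloch_norm_zero_iff[OF bloch_space_diff[OF fh]] bloch_space_cong[OF fh]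
    by (auto simp: bloch_dist_def simp del: mem_ball)
next
  fix f h k assume m: "f \<in> bloch_space" "h \<in> bloch_space" "k \<in> bloch_space"
  let ?d = "\<lambda>f h. \<lambda>z\<in>\<bbbD>. f z - h z :: complex"
  have "bloch_seminorm (?d f k) \<le> bloch_seminorm (?d f h) + bloch_seminorm (?d h k)"
    unfolding bloch_seminorm_def[of "?d f k"]
  proof (rule cSUP_least)
    fix z assume z: "z \<in> \<bbbD>"
    let ?w = "1 - (cmod z)\<^sup>2"
    have "cmod (deriv f z - deriv k z) \<le> cmod (deriv f z - deriv h z) + cmod (deriv h z - deriv k z)"
      by (metis diff_add_cancel add_diff_eq norm_triangle_ineq)
    then have "?w * cmod (deriv f z - deriv k z)
        \<le> ?w * cmod (deriv f z - deriv h z) + ?w * cmod (deriv h z - deriv k z)"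
      by (metis disk_weight_nonneg[OF z] distrib_left mult_left_mono)
    then show "?w * cmod (deriv (?d f k) z) \<le> bloch_seminorm (?d f h) + bloch_seminorm (?d h k)"
      using bloch_seminorm_bound[OF bloch_space_diff[OF m(1,2)] z]
        bloch_seminorm_bound[OF bloch_space_diff[OF m(2,3)] z] m z
      by (simp add: deriv_bloch_diff del: mem_ball)
  qed simp
  moreover have "cmod (f 0 - k 0) \<le> cmod (f 0 - h 0) + cmod (h 0 - k 0)"
    by (metis diff_add_cancel add_diff_eq norm_triangle_ineq)
  ultimately show "bloch_dist f k \<le> bloch_dist f h + bloch_dist h k"
    using m by (simp add: bloch_dist_def bloch_norm_def)
qed

end

theory Submission
  imports Defs "HOL-Real_Asymp.Real_Asymp"
begin

text \<open>Write \<open>L z = ln (2 / (1 - \<bar>z\<bar>\<^sup>2))\<close>. A Bloch function is bounded by a multiple of \<open>L\<close>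
  (\<open>bloch_growth\<close>), and up to a constant some Bloch functions of norm at most one attain this growth
  at a prescribed point. Since \<open>(J\<^sub>g f)' = f g'\<close>, boundedness of \<open>J\<^sub>g\<close> forces
  \<open>W \<bar>g'\<bar> \<le> C\<close> for the weight \<open>W z = (1 - \<bar>z\<bar>\<^sup>2) L z\<close>, and the condition in question is
  \<open>W \<bar>g'\<bar> \<rightarrow> 0\<close>, its little-o version.

  Necessity uses only the rotations \<open>\<phi> z = u z\<close> with \<open>\<bar>u\<bar> = 1\<close>. The derivative of the commutator is
  \<open>f (u z) (u g' (u z) - g' z)\<close>. The functions \<open>peak_test a\<close> are of size \<open>L a\<close> at \<open>a\<close>, lie in the unit
  ball, and tend to zero pointwise as \<open>\<bar>a\<bar> \<rightarrow> 1\<close>; a compact commutator therefore maps them to a norm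
  null sequence, whence \<open>W z \<bar>u g' (u z) - g' z\<bar> \<rightarrow> 0\<close> for each fixed \<open>u\<close>
  (\<open>compact_commutator_imp_tendsto\<close>). The mean of \<open>u g' (u z)\<close> over the unit circle is zero, because
  \<open>2 \<pi> \<i> z u g' (u z)\<close> is the derivative of \<open>t \<mapsto> g (u z)\<close> along \<open>u = exp (2 \<pi> \<i> t)\<close>. Hence the mean
  of the difference is \<open>- g' z\<close>. As \<open>W \<bar>g'\<bar> \<le> C\<close> dominates the integrands by \<open>2 C\<close>, dominated
  convergence turns the limits for single rotations into \<open>W \<bar>g'\<bar> \<rightarrow> 0\<close>
  (\<open>rotation_differences_imp_tendsto\<close>).

  For sufficiency, the little-o condition makes \<open>J\<^sub>g\<close> send norm-bounded sequences that vanish locally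
  uniformly to norm null sequences (\<open>volterra_null_sequence\<close>): near the circle the condition beats the
  growth of Bloch functions, and inside a smaller disk \<open>g'\<close> is bounded. Composition with \<open>\<phi>\<close> is bounded
  on the Bloch space by the Schwarz-Pick inequality and respects locally uniform convergence, so both
  products have the same property. Montel's theorem supplies convergent subsequences of the unit ball.\<close>

section \<open>The Bloch space\<close>

lemma bloch_holomorphic: "f \<in> bloch_space \<Longrightarrow> f holomorphic_on \<bbbD>"
  by (simp add: bloch_space_def)

lemma bloch_norm_nonneg: "f \<in> bloch_space \<Longrightarrow> 0 \<le> bloch_norm f"
  using bloch_seminorm_nonneg by (simp add: bloch_norm_def)

lemma bloch_spaceI:
  assumes "f \<in> extensional \<bbbD>" "f holomorphic_on \<bbbD>"
    and "\<And>z. z \<in> \<bbbD> \<Longrightarrow> (1 - (cmod z)\<^sup>2) * cmod (deriv f z) \<le> K"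
  shows "f \<in> bloch_space"
  using assms unfolding bloch_space_def by (auto intro!: bdd_aboveI2)

lemma bloch_seminorm_le:
  assumes "\<And>z. z \<in> \<bbbD> \<Longrightarrow> (1 - (cmod z)\<^sup>2) * cmod (deriv f z) \<le> K"
  shows "bloch_seminorm f \<le> K"
  unfolding bloch_seminorm_def by (rule cSUP_least) (use assms in auto)

lemma restrict_holomorphic: "f holomorphic_on \<bbbD> \<Longrightarrow> (\<lambda>z\<in>\<bbbD>. f z) holomorphic_on \<bbbD>"
  by (rule holomorphic_transform) auto

lemma bloch_norm_diff_le:
  assumes "f \<in> bloch_space" "h \<in> bloch_space"
  shows "bloch_norm (\<lambda>z\<in>\<bbbD>. f z - h z) \<le> bloch_norm f + bloch_norm h"
  using bloch_seminorm_le[OF bloch_diff_bound[OF assms]] norm_triangle_ineq4[of "f 0" "h 0"]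
  by (simp add: bloch_norm_def)

text \<open>Convergence in the Bloch metric controls derivatives at each point, and uniformly in the
  point once the weight is included.\<close>

lemma bloch_dist_deriv:
  assumes "f \<in> bloch_space" "h \<in> bloch_space" "z \<in> \<bbbD>"
  shows "(1 - (cmod z)\<^sup>2) * cmod (deriv f z - deriv h z) \<le> bloch_dist f h"
proof -
  have "(1 - (cmod z)\<^sup>2) * cmod (deriv f z - deriv h z) \<le> bloch_seminorm (\<lambda>z\<in>\<bbbD>. f z - h z)"
    using bloch_seminorm_bound[OF bloch_space_diff[OF assms(1,2)] assms(3)]
    by (simp add: deriv_bloch_diff[OF assms])
  also have "\<dots> \<le> bloch_dist f h"
    using assms by (simp add: bloch_dist_def bloch_norm_def)
  finally show ?thesis .
qed

lemma bloch_linear_maps: "bloch_linear T \<Longrightarrow> f \<in> bloch_space \<Longrightarrow> T f \<in> bloch_space"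
  unfolding bloch_linear_def by (simp add: image_subset_iff)

section \<open>Growth of functions on the disk\<close>

definition log_weight :: "complex \<Rightarrow> real"
  where "log_weight z = ln (2 / (1 - (cmod z)\<^sup>2))"

lemma disk_weight_pos: "cmod z < 1 \<Longrightarrow> 0 < 1 - (cmod z)\<^sup>2"
  by (simp add: abs_square_less_1)

lemma ln_2_ge_half: "1/2 \<le> ln (2::real)"
  using ln_add_one_self_le_self2[of "-1/2::real"] ln_div[of 1 "2::real"] by simp

lemma ln_2_le_1: "ln (2::real) \<le> 1"
  using ln_le_minus_one[of "2::real"] by simp

lemma log_weight_ge_ln_2:
  assumes "cmod z < 1" shows "ln 2 \<le> log_weight z"
  unfolding log_weight_def using disk_weight_pos[OF assms]
  by (subst ln_le_cancel_iff) (auto simp: field_simps)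

lemma log_weight_ge_half: "cmod z < 1 \<Longrightarrow> 1/2 \<le> log_weight z"
  using log_weight_ge_ln_2 ln_2_ge_half by fastforce

lemma minus_ln_le_log_weight:
  assumes "cmod z < 1" shows "- ln (1 - cmod z) \<le> log_weight z"
proof -
  have "1 - (cmod z)\<^sup>2 = (1 - cmod z) * (1 + cmod z)"
    by (simp add: power2_eq_square algebra_simps)
  also have "\<dots> \<le> (1 - cmod z) * 2"
    using assms by (intro mult_left_mono) auto
  finally have "inverse (1 - cmod z) \<le> 2 / (1 - (cmod z)\<^sup>2)"
    using assms disk_weight_pos[OF assms] by (simp add: field_simps)
  then have "ln (inverse (1 - cmod z)) \<le> log_weight z"
    unfolding log_weight_def using assms disk_weight_pos[OF assms] by (subst ln_le_cancel_iff) auto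
  then show ?thesis using assms by (simp add: ln_inverse)
qed

text \<open>Integrating the bound along the segment from \<open>0\<close> to \<open>z\<close> gives the logarithm. The mean value
  inequality for the pair \<open>t \<mapsto> f (t z)\<close>, \<open>t \<mapsto> - M ln (1 - t \<bar>z\<bar>)\<close> replaces the integral.\<close>

lemma radial_growth:
  assumes hol: "f holomorphic_on \<bbbD>"
    and bound: "\<And>z. z \<in> \<bbbD> \<Longrightarrow> cmod (deriv f z) \<le> M / (1 - cmod z)"
    and z: "z \<in> \<bbbD>"
  shows "cmod (f z - f 0) \<le> - M * ln (1 - cmod z)"
proof -
  have in_disk: "of_real t * z \<in> \<bbbD>" if "0 \<le> t" "t \<le> 1" for t
    using that z mult_left_le_one_le[of "cmod z" t] by (auto simp: norm_mult)
  have pos: "0 < 1 - t * cmod z" if "0 \<le> t" "t \<le> 1" for t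
    using in_disk[OF that] that by (simp add: norm_mult)
  have "cmod (f (of_real 1 * z) - f (of_real 0 * z))
      \<le> - M * ln (1 - 1 * cmod z) - (- M * ln (1 - 0 * cmod z))"
  proof (rule differentiable_bound_general)
    have "continuous_on {0..1::real} (f \<circ> (\<lambda>t. of_real t * z))"
      using in_disk
      by (intro continuous_on_compose continuous_intros
          continuous_on_subset[OF holomorphic_on_imp_continuous_on[OF hol]]) auto
    then show "continuous_on {0..1::real} (\<lambda>t. f (of_real t * z))"
      by (simp add: o_def)
    show "continuous_on {0..1} (\<lambda>t. - M * ln (1 - t * cmod z))"
    proof (intro continuous_intros ballI)
      show "1 - t * cmod z \<noteq> 0" if "t \<in> {0..1}" for t using pos[of t] that by auto
    qed
  next
    fix t :: real assume t: "0 < t" "t < 1"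
    have "(f has_field_derivative deriv f (of_real t * z)) (at (of_real t * z))"
      using in_disk[of t] t by (intro holomorphic_derivI[OF hol]) auto
    moreover have "((\<lambda>t. of_real t * z) has_vector_derivative z) (at t)"
      by (auto intro!: derivative_eq_intros)
    ultimately have "(f \<circ> (\<lambda>t. of_real t * z) has_vector_derivative z * deriv f (of_real t * z)) (at t)"
      by (intro field_vector_diff_chain_at)
    then show "((\<lambda>t. f (of_real t * z)) has_vector_derivative z * deriv f (of_real t * z)) (at t)"
      by (simp add: o_def)
    show "((\<lambda>t. - M * ln (1 - t * cmod z)) has_vector_derivative M * cmod z / (1 - t * cmod z)) (at t)"
      unfolding has_real_derivative_iff_has_vector_derivative[symmetric]
      using pos[of t] t by (auto intro!: derivative_eq_intros simp: field_simps)
    have "cmod (deriv f (of_real t * z)) \<le> M / (1 - t * cmod z)"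
      using bound[OF in_disk[of t]] t by (simp add: norm_mult)
    then show "cmod (z * deriv f (of_real t * z)) \<le> M * cmod z / (1 - t * cmod z)"
      using mult_left_mono[of "cmod (deriv f (of_real t * z))" "M / (1 - t * cmod z)" "cmod z"]
      by (simp add: norm_mult mult.commute)
  qed simp
  then show ?thesis by simp
qed

text \<open>The constant 2 comes from \<open>1 \<le> 2 ln 2\<close>, which lets the weight absorb the value at the origin.\<close>

lemma bloch_growth:
  assumes f: "f \<in> bloch_space" and z: "z \<in> \<bbbD>"
  shows "cmod (f z) \<le> 2 * bloch_norm f * log_weight z"
proof -
  have "cmod (deriv f w) \<le> bloch_seminorm f / (1 - cmod w)" if w: "w \<in> \<bbbD>" for w
  proof -
    have "(cmod w)\<^sup>2 \<le> cmod w"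
      using w by (simp add: power2_eq_square mult_left_le_one_le)
    then have "(1 - cmod w) * cmod (deriv f w) \<le> (1 - (cmod w)\<^sup>2) * cmod (deriv f w)"
      by (intro mult_right_mono) auto
    also have "\<dots> \<le> bloch_seminorm f"
      by (rule bloch_seminorm_bound[OF f w])
    finally show ?thesis
      using w by (simp add: field_simps)
  qed
  then have "cmod (f z - f 0) \<le> - bloch_seminorm f * ln (1 - cmod z)"
    using f z by (intro radial_growth) (auto simp: bloch_space_def)
  also have "\<dots> \<le> bloch_seminorm f * log_weight z"
    using mult_left_mono[OF minus_ln_le_log_weight bloch_seminorm_nonneg[OF f], of z] z by simp
  also have "\<dots> \<le> bloch_seminorm f * (2 * log_weight z)"
    using bloch_seminorm_nonneg[OF f] log_weight_ge_half[of z] z by (intro mult_left_mono) auto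
  finally have "cmod (f z - f 0) \<le> bloch_seminorm f * (2 * log_weight z)" .
  moreover have "cmod (f 0) \<le> cmod (f 0) * (2 * log_weight z)"
    using mult_left_mono[of 1 "2 * log_weight z" "cmod (f 0)"] log_weight_ge_half[of z] z by simp
  moreover have "cmod (f z) \<le> cmod (f 0) + cmod (f z - f 0)"
    using norm_triangle_ineq[of "f 0" "f z - f 0"] by simp
  ultimately show ?thesis
    by (simp add: bloch_norm_def algebra_simps)
qed

section \<open>Composition operators\<close>

text \<open>The Schwarz lemma at the origin, transported by the disk automorphisms that take the origin to
  \<open>z\<close> and \<open>\<phi> z\<close> to the origin.\<close>

lemma Schwarz_Pick_deriv:
  assumes phi: "\<phi> \<in> disk_selfmaps" and z: "z \<in> \<bbbD>"
  shows "(1 - (cmod z)\<^sup>2) * cmod (deriv \<phi> z) \<le> 1 - (cmod (\<phi> z))\<^sup>2"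
proof -
  define a where "a = \<phi> z"
  let ?P = "Moebius_function 0 (- z)" and ?Q = "Moebius_function 0 a"
  have hol: "\<phi> holomorphic_on \<bbbD>" and maps: "\<And>w. w \<in> \<bbbD> \<Longrightarrow> \<phi> w \<in> \<bbbD>"
    using phi by (auto simp: disk_selfmaps_def image_subset_iff)
  have a: "cmod a < 1" using maps[OF z] by (simp add: a_def)
  have P0: "?P 0 = z" and Qa: "?Q a = 0"
    by (simp_all add: Moebius_function_of_zero Moebius_function_eq_zero)
  have weight: "of_real (1 - (cmod w)\<^sup>2) = 1 - cnj w * w" for w
    using complex_norm_square[of w] by (simp add: mult.commute)
  have dP: "(?P has_field_derivative of_real (1 - (cmod z)\<^sup>2)) (at 0)"
    unfolding Moebius_function_simple weight
    by (auto intro!: derivative_eq_intros)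
  have nz: "1 - cnj a * a \<noteq> 0"
    using disk_weight_pos[OF a] unfolding weight[symmetric] of_real_eq_0_iff by simp
  have dQ: "(?Q has_field_derivative 1 / of_real (1 - (cmod a)\<^sup>2)) (at a)"
  proof -
    have "((\<lambda>w. w - a) has_field_derivative 1) (at a)"
      "((\<lambda>w. 1 - cnj a * w) has_field_derivative - cnj a) (at a)"
      by (auto intro!: derivative_eq_intros)
    from DERIV_divide[OF this nz] show ?thesis
      unfolding Moebius_function_simple weight by (rule DERIV_cong) (use nz in simp)
  qed
  have dphi: "(\<phi> has_field_derivative deriv \<phi> z) (at (?P 0))"
    using holomorphic_derivI[OF hol _ z] P0 by simp
  have inner: "(\<phi> \<circ> ?P has_field_derivative deriv \<phi> z * of_real (1 - (cmod z)\<^sup>2)) (at 0)"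
    by (rule DERIV_chain[OF dphi dP])
  have outer: "(?Q has_field_derivative 1 / of_real (1 - (cmod a)\<^sup>2)) (at ((\<phi> \<circ> ?P) 0))"
    using dQ P0 by (simp add: a_def)
  have "(?Q \<circ> (\<phi> \<circ> ?P) has_field_derivative
      1 / of_real (1 - (cmod a)\<^sup>2) * (deriv \<phi> z * of_real (1 - (cmod z)\<^sup>2))) (at 0)"
    by (rule DERIV_chain[OF outer inner])
  then have eq: "deriv (?Q \<circ> (\<phi> \<circ> ?P)) 0
      = 1 / of_real (1 - (cmod a)\<^sup>2) * (deriv \<phi> z * of_real (1 - (cmod z)\<^sup>2))"
    by (rule DERIV_imp_deriv)
  have P: "?P w \<in> \<bbbD>" if "w \<in> \<bbbD>" for w
    using that z unfolding mem_ball_0 by (intro Moebius_function_norm_lt_1) simp_all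
  have Q: "?Q w \<in> \<bbbD>" if "w \<in> \<bbbD>" for w
    using that a unfolding mem_ball_0 by (intro Moebius_function_norm_lt_1) simp_all
  have "\<phi> \<circ> ?P holomorphic_on \<bbbD>"
    by (rule holomorphic_on_compose_gen[OF Moebius_function_holomorphic hol])
      (use z P in \<open>simp_all add: image_subset_iff\<close>)
  then have "?Q \<circ> (\<phi> \<circ> ?P) holomorphic_on \<bbbD>"
    by (rule holomorphic_on_compose_gen[OF _ Moebius_function_holomorphic])
      (use a P maps in \<open>simp_all add: image_subset_iff\<close>)
  then have "cmod (deriv (?Q \<circ> (\<phi> \<circ> ?P)) 0) \<le> 1"
    using P Q maps P0 Qa by (intro Schwarz_Lemma(2)[of _ 0]) (auto simp: a_def)
  then have "cmod (1 / of_real (1 - (cmod a)\<^sup>2) * (deriv \<phi> z * of_real (1 - (cmod z)\<^sup>2))) \<le> 1"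
    unfolding eq .
  then show ?thesis
    using disk_weight_pos[OF a] disk_weight_pos[of z] z
    unfolding norm_mult norm_divide norm_of_real a_def[symmetric] by (simp add: field_simps)
qed

lemma disk_selfmap_in: "\<phi> \<in> disk_selfmaps \<Longrightarrow> z \<in> \<bbbD> \<Longrightarrow> \<phi> z \<in> \<bbbD>"
  by (auto simp: disk_selfmaps_def image_subset_iff)

lemma deriv_composition_op:
  assumes phi: "\<phi> \<in> disk_selfmaps" and f: "f holomorphic_on \<bbbD>" and z: "z \<in> \<bbbD>"
  shows "deriv (composition_op \<phi> f) z = deriv f (\<phi> z) * deriv \<phi> z"
proof -
  have "deriv (composition_op \<phi> f) z = deriv (f \<circ> \<phi>) z"
    unfolding composition_op_def o_def by (rule deriv_restrict_disk[OF z])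
  also have "\<dots> = deriv f (\<phi> z) * deriv \<phi> z"
    using phi z disk_selfmap_in[OF phi z] f unfolding disk_selfmaps_def
    by (intro deriv_chain holomorphic_on_imp_differentiable_at[of _ \<bbbD>]) auto
  finally show ?thesis .
qed

lemma composition_op_holomorphic:
  assumes "\<phi> \<in> disk_selfmaps" "f holomorphic_on \<bbbD>"
  shows "composition_op \<phi> f holomorphic_on \<bbbD>"
  using assms holomorphic_on_compose_gen[of \<phi> \<bbbD> f \<bbbD>] restrict_holomorphic
  unfolding composition_op_def disk_selfmaps_def o_def by auto

text \<open>By Schwarz-Pick, composition does not increase the Bloch seminorm. Only the value at the origin
  can make its operator norm exceed one.\<close>

lemma composition_op_contracts:
  assumes phi: "\<phi> \<in> disk_selfmaps" and f: "f \<in> bloch_space" and z: "z \<in> \<bbbD>"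
  shows "(1 - (cmod z)\<^sup>2) * cmod (deriv (composition_op \<phi> f) z) \<le> bloch_seminorm f"
proof -
  have hol: "f holomorphic_on \<bbbD>" using f by (simp add: bloch_space_def)
  have "(1 - (cmod z)\<^sup>2) * cmod (deriv (composition_op \<phi> f) z)
      = cmod (deriv f (\<phi> z)) * ((1 - (cmod z)\<^sup>2) * cmod (deriv \<phi> z))"
    by (simp add: deriv_composition_op[OF phi hol z] norm_mult)
  also have "\<dots> \<le> cmod (deriv f (\<phi> z)) * (1 - (cmod (\<phi> z))\<^sup>2)"
    by (intro mult_left_mono Schwarz_Pick_deriv[OF phi z]) auto
  also have "\<dots> \<le> bloch_seminorm f"
    using bloch_seminorm_bound[OF f disk_selfmap_in[OF phi z]] by (simp add: mult.commute)
  finally show ?thesis .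
qed

lemma composition_op_bloch:
  assumes phi: "\<phi> \<in> disk_selfmaps" and f: "f \<in> bloch_space"
  shows "composition_op \<phi> f \<in> bloch_space"
  using f composition_op_contracts[OF assms] composition_op_holomorphic[OF phi, of f]
  by (intro bloch_spaceI) (auto simp: composition_op_def bloch_space_def)

lemma bloch_norm_composition_op:
  assumes phi: "\<phi> \<in> disk_selfmaps" and f: "f \<in> bloch_space"
  shows "bloch_norm (composition_op \<phi> f) \<le> (2 * log_weight (\<phi> 0) + 1) * bloch_norm f"
proof -
  have "bloch_seminorm (composition_op \<phi> f) \<le> bloch_norm f"
    using bloch_seminorm_le[OF composition_op_contracts[OF assms]] norm_ge_zero[of "f 0"]
    unfolding bloch_norm_def[of f] by linarith
  moreover have "cmod (composition_op \<phi> f 0) \<le> 2 * bloch_norm f * log_weight (\<phi> 0)"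
    using bloch_growth[OF f disk_selfmap_in[OF phi, of 0]] by (simp add: composition_op_def)
  ultimately show ?thesis
    by (simp add: bloch_norm_def[of "composition_op \<phi> f"] algebra_simps)
qed

section \<open>The Volterra operator and the commutators\<close>

lemma volterra_primitive:
  assumes g: "g holomorphic_on \<bbbD>" and f: "f holomorphic_on \<bbbD>" and z: "z \<in> \<bbbD>"
  shows "(volterra_op g f has_field_derivative f z * deriv g z) (at z)"
proof -
  have "(\<lambda>\<zeta>. f \<zeta> * deriv g \<zeta>) holomorphic_on \<bbbD>"
    using f g by (intro holomorphic_intros) auto
  then obtain F where F: "\<And>w. w \<in> \<bbbD> \<Longrightarrow> (F has_field_derivative f w * deriv g w) (at w within \<bbbD>)"
    using holomorphic_convex_primitive'[OF convex_ball open_ball] by blast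
  have eq: "volterra_op g f w = F w - F 0" if "w \<in> \<bbbD>" for w
  proof -
    have "closed_segment 0 w \<subseteq> \<bbbD>"
      using that by (intro closed_segment_subset) auto
    then have "((\<lambda>\<zeta>. f \<zeta> * deriv g \<zeta>) has_contour_integral F w - F 0) (linepath 0 w)"
      using contour_integral_primitive[OF F, of "linepath 0 w"] by simp
    then show ?thesis
      using that by (simp add: volterra_op_def contour_integral_unique)
  qed
  have "((\<lambda>w. F w - F 0) has_field_derivative f z * deriv g z) (at z)"
    using F[OF z] z by (auto intro!: derivative_eq_intros simp: at_within_open[of z \<bbbD>])
  then show ?thesis
    by (rule has_field_derivative_transform_within_open[of _ _ _ \<bbbD>]) (use z eq in auto)
qed

lemma deriv_volterra_op:
  assumes "g holomorphic_on \<bbbD>" "f holomorphic_on \<bbbD>" "z \<in> \<bbbD>"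
  shows "deriv (volterra_op g f) z = f z * deriv g z"
  by (rule DERIV_imp_deriv[OF volterra_primitive[OF assms]])

lemma volterra_op_holomorphic:
  assumes "g holomorphic_on \<bbbD>" "f holomorphic_on \<bbbD>"
  shows "volterra_op g f holomorphic_on \<bbbD>"
  using volterra_primitive[OF assms] unfolding holomorphic_on_open[OF open_ball] by blast

lemma volterra_op_0: "volterra_op g f 0 = 0"
  by (simp add: volterra_op_def)

lemma bloch_linear_composition_op:
  assumes "\<phi> \<in> disk_selfmaps" shows "bloch_linear (composition_op \<phi>)"
  using composition_op_bloch[OF assms] disk_selfmap_in[OF assms]
  unfolding bloch_linear_def composition_op_def by (auto simp: fun_eq_iff restrict_def)

lemma bloch_linear_comp:
  assumes S: "bloch_linear S" and T: "bloch_linear T"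
  shows "bloch_linear (S \<circ> T)"
  unfolding bloch_linear_def
proof (intro conjI ballI allI)
  show "(S \<circ> T) ` bloch_space \<subseteq> bloch_space"
    using bloch_linear_maps[OF S] bloch_linear_maps[OF T] by auto
  fix f h and a b :: complex assume fh: "f \<in> bloch_space" "h \<in> bloch_space"
  show "(S \<circ> T) (\<lambda>z\<in>\<bbbD>. a * f z + b * h z) = (\<lambda>z\<in>\<bbbD>. a * (S \<circ> T) f z + b * (S \<circ> T) h z)"
    using S T fh bloch_linear_maps[OF T] unfolding bloch_linear_def by simp
qed

lemma bloch_linear_op_diff:
  assumes S: "bloch_linear S" and T: "bloch_linear T"
  shows "bloch_linear (op_diff S T)"
  unfolding bloch_linear_def
proof (intro conjI ballI allI)
  show "op_diff S T ` bloch_space \<subseteq> bloch_space"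
    using bloch_space_diff[OF bloch_linear_maps[OF S] bloch_linear_maps[OF T]]
    by (auto simp: op_diff_def)
  fix f h and a b :: complex assume fh: "f \<in> bloch_space" "h \<in> bloch_space"
  show "op_diff S T (\<lambda>z\<in>\<bbbD>. a * f z + b * h z) = (\<lambda>z\<in>\<bbbD>. a * op_diff S T f z + b * op_diff S T h z)"
    using S T fh unfolding bloch_linear_def
    by (auto simp: op_diff_def fun_eq_iff restrict_def algebra_simps)
qed

lemma bloch_linear_diff:
  assumes "bloch_linear T" "f \<in> bloch_space" "h \<in> bloch_space"
  shows "T (\<lambda>z\<in>\<bbbD>. f z - h z) = (\<lambda>z\<in>\<bbbD>. T f z - T h z)"
proof -
  have "T (\<lambda>z\<in>\<bbbD>. 1 * f z + (-1) * h z) = (\<lambda>z\<in>\<bbbD>. 1 * T f z + (-1) * T h z)"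
    using assms unfolding bloch_linear_def by blast
  then show ?thesis by simp
qed

abbreviation commutator :: "(complex \<Rightarrow> complex) \<Rightarrow> (complex \<Rightarrow> complex) \<Rightarrow> (complex \<Rightarrow> complex) \<Rightarrow> complex \<Rightarrow> complex"
  where "commutator g \<phi> \<equiv> op_diff (composition_op \<phi> \<circ> volterra_op g) (volterra_op g \<circ> composition_op \<phi>)"

text \<open>Both products differentiate to a multiple of \<open>f \<circ> \<phi>\<close>, so the derivative of the commutator is a
  weighted composition of \<open>f\<close>.\<close>

lemma deriv_commutator:
  assumes g: "g holomorphic_on \<bbbD>" and phi: "\<phi> \<in> disk_selfmaps"
    and f: "f holomorphic_on \<bbbD>" and z: "z \<in> \<bbbD>"
  shows "deriv (commutator g \<phi> f) z = f (\<phi> z) * (deriv \<phi> z * deriv g (\<phi> z) - deriv g z)"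
proof -
  let ?CJ = "composition_op \<phi> (volterra_op g f)" and ?JC = "volterra_op g (composition_op \<phi> f)"
  have CJ: "?CJ holomorphic_on \<bbbD>"
    by (intro composition_op_holomorphic volterra_op_holomorphic phi g f)
  have JC: "?JC holomorphic_on \<bbbD>"
    by (intro composition_op_holomorphic volterra_op_holomorphic phi g f)
  have "deriv (commutator g \<phi> f) z = deriv (\<lambda>w. ?CJ w - ?JC w) z"
    unfolding op_diff_def o_def by (rule deriv_restrict_disk[OF z])
  also have "\<dots> = deriv ?CJ z - deriv ?JC z"
    using CJ JC z by (intro deriv_diff holomorphic_on_imp_differentiable_at[of _ \<bbbD>]) auto
  also have "deriv ?CJ z = f (\<phi> z) * deriv g (\<phi> z) * deriv \<phi> z"
    by (simp add: deriv_composition_op[OF phi volterra_op_holomorphic[OF g f] z]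
        deriv_volterra_op[OF g f disk_selfmap_in[OF phi z]])
  also have "deriv ?JC z = f (\<phi> z) * deriv g z"
    using deriv_volterra_op[OF g composition_op_holomorphic[OF phi f] z] z
    by (simp add: composition_op_def)
  finally show ?thesis
    unfolding right_diff_distrib by (simp only: mult_ac)
qed

section \<open>Logarithmic test functions\<close>

text \<open>A branch of \<open>ln (2 / (1 - cnj a * z))\<close>: it attains the largest growth
  that the Bloch space permits, up to a constant, at \<open>z = a\<close>.\<close>

definition log_test :: "complex \<Rightarrow> complex \<Rightarrow> complex"
  where "log_test a = (\<lambda>z\<in>\<bbbD>. of_real (ln 2) - Ln (1 - cnj a * z))"

lemma one_minus_not_nonpos: "cmod w < 1 \<Longrightarrow> 1 - w \<notin> \<real>\<^sub>\<le>\<^sub>0"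
  using abs_Re_le_cmod[of w] by (auto simp: complex_nonpos_Reals_iff)

lemma cmod_cnj_mult_less:
  assumes "cmod a < 1" "cmod z < 1" shows "cmod (cnj a * z) < 1"
  using mult_strict_mono'[OF assms] by (simp add: norm_mult)

lemma norm_Ln_one_minus_le:
  assumes "cmod w < 1" shows "cmod (Ln (1 - w)) \<le> - ln (1 - cmod w)"
proof -
  have d: "((\<lambda>w. Ln (1 - w)) has_field_derivative - 1 / (1 - w)) (at w)" if "w \<in> \<bbbD>" for w
    using one_minus_not_nonpos[of w] that
    by (auto intro!: derivative_eq_intros simp: divide_inverse)
  have "(\<lambda>w. Ln (1 - w)) holomorphic_on \<bbbD>"
    using d unfolding holomorphic_on_open[OF open_ball] by blast
  moreover have "cmod (deriv (\<lambda>w. Ln (1 - w)) w) \<le> 1 / (1 - cmod w)" if "w \<in> \<bbbD>" for w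
    using DERIV_imp_deriv[OF d[OF that]] that norm_triangle_ineq2[of 1 w]
    by (simp add: norm_divide frac_le)
  ultimately show ?thesis
    using radial_growth[of "\<lambda>w. Ln (1 - w)" 1 w] assms by simp
qed

text \<open>Two choices of \<open>b\<close> matter: \<open>b = a\<close> gives a bound uniform in \<open>z\<close>, and \<open>b = z\<close> gives one uniform
  in \<open>a\<close>.\<close>

lemma log_test_bound:
  assumes a: "cmod a < 1" and z: "cmod z < 1" and b: "cmod b < 1" "cmod (cnj a * z) \<le> cmod b"
  shows "cmod (log_test a z) \<le> 2 * log_weight b"
proof -
  have "cmod (log_test a z) \<le> ln 2 + cmod (Ln (1 - cnj a * z))"
    using norm_triangle_ineq4[of "of_real (ln 2)" "Ln (1 - cnj a * z)"] z by (simp add: log_test_def)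
  also have "cmod (Ln (1 - cnj a * z)) \<le> - ln (1 - cmod (cnj a * z))"
    by (rule norm_Ln_one_minus_le[OF cmod_cnj_mult_less[OF a z]])
  also have "\<dots> \<le> - ln (1 - cmod b)"
    using b by simp
  also have "\<dots> \<le> log_weight b"
    by (rule minus_ln_le_log_weight[OF b(1)])
  finally show ?thesis
    using log_weight_ge_ln_2[OF b(1)] by simp
qed

lemma log_test_bound_pole:
  assumes "cmod a < 1" "cmod z < 1" shows "cmod (log_test a z) \<le> 2 * log_weight a"
  using assms by (intro log_test_bound) (auto simp: norm_mult mult_left_le)

lemma log_test_bound_arg:
  assumes "cmod a < 1" "cmod z < 1" shows "cmod (log_test a z) \<le> 2 * log_weight z"
  using assms by (intro log_test_bound) (auto simp: norm_mult mult_left_le_one_le)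

lemma log_test_self:
  assumes "cmod a < 1" shows "log_test a a = of_real (log_weight a)"
proof -
  have "1 - cnj a * a = of_real (1 - (cmod a)\<^sup>2)"
    using complex_norm_square[of a] by (simp add: mult.commute)
  then have "Ln (1 - cnj a * a) = of_real (ln (1 - (cmod a)\<^sup>2))"
    using Ln_of_real[OF disk_weight_pos[OF assms]] by simp
  then show ?thesis
    using assms disk_weight_pos[OF assms] by (simp add: log_test_def log_weight_def ln_div)
qed

lemma log_test_deriv:
  assumes a: "cmod a < 1" and z: "z \<in> \<bbbD>"
  shows "(log_test a has_field_derivative cnj a / (1 - cnj a * z)) (at z)"
proof -
  have "((\<lambda>z. of_real (ln 2) - Ln (1 - cnj a * z)) has_field_derivative cnj a / (1 - cnj a * z)) (at z)"
    using one_minus_not_nonpos[OF cmod_cnj_mult_less[OF a, of z]] z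
    by (auto intro!: derivative_eq_intros simp: divide_inverse)
  then show ?thesis
    by (rule has_field_derivative_transform_within_open[of _ _ _ \<bbbD>])
      (use z in \<open>auto simp: log_test_def\<close>)
qed

lemma log_test_deriv_bound:
  assumes a: "cmod a < 1" and z: "z \<in> \<bbbD>"
  shows "(1 - (cmod z)\<^sup>2) * cmod (deriv (log_test a) z) \<le> 2"
proof -
  have z1: "cmod z < 1" using z by simp
  have "cmod (cnj a * z) \<le> cmod z"
    using a z by (simp add: norm_mult mult_left_le_one_le)
  then have le: "1 - cmod z \<le> cmod (1 - cnj a * z)"
    using norm_triangle_ineq2[of 1 "cnj a * z"] by simp
  have "cmod (deriv (log_test a) z) \<le> 1 / (1 - cmod z)"
    using DERIV_imp_deriv[OF log_test_deriv[OF a z]] a z1 le by (simp add: norm_divide frac_le)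
  then have "(1 - (cmod z)\<^sup>2) * cmod (deriv (log_test a) z) \<le> (1 - (cmod z)\<^sup>2) * (1 / (1 - cmod z))"
    using disk_weight_nonneg[OF z] by (intro mult_left_mono)
  also have "\<dots> = 1 + cmod z"
    using z1 by (simp add: field_simps power2_eq_square)
  finally show ?thesis using z1 by simp
qed

lemma log_test_bloch:
  assumes a: "cmod a < 1"
  shows "log_test a \<in> bloch_space" and "bloch_norm (log_test a) \<le> 3"
proof -
  have "log_test a holomorphic_on \<bbbD>"
    using log_test_deriv[OF a] unfolding holomorphic_on_open[OF open_ball] by blast
  then show "log_test a \<in> bloch_space"
    using log_test_deriv_bound[OF a] by (intro bloch_spaceI) (auto simp: log_test_def)
  have "log_test a 0 = of_real (ln 2)"
    by (simp add: log_test_def)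
  then have "cmod (log_test a 0) \<le> 1"
    using ln_2_le_1 ln_2_ge_half by (simp only: norm_of_real)
  then show "bloch_norm (log_test a) \<le> 3"
    using bloch_seminorm_le[OF log_test_deriv_bound[OF a]] by (simp add: bloch_norm_def)
qed

text \<open>The squared logarithm divided by its size at \<open>a\<close> still grows like \<open>log_weight a\<close> at \<open>a\<close>, but tends to
  zero at every fixed point as \<open>a\<close> approaches the circle. The factor 9 puts it into the unit ball.\<close>

definition peak_test :: "complex \<Rightarrow> complex \<Rightarrow> complex"
  where "peak_test a = (\<lambda>z\<in>\<bbbD>. (log_test a z)\<^sup>2 / of_real (9 * log_weight a))"

lemma peak_test_deriv:
  assumes a: "cmod a < 1" and z: "z \<in> \<bbbD>"
  shows "(peak_test a has_field_derivative
    2 * log_test a z * deriv (log_test a) z / of_real (9 * log_weight a)) (at z)"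
proof -
  have "(log_test a has_field_derivative deriv (log_test a) z) (at z)"
    using log_test_deriv[OF a z] DERIV_imp_deriv by metis
  then have "((\<lambda>z. (log_test a z)\<^sup>2 / of_real (9 * log_weight a)) has_field_derivative
    2 * log_test a z * deriv (log_test a) z / of_real (9 * log_weight a)) (at z)"
    using log_weight_ge_half[OF a] by (auto intro!: derivative_eq_intros)
  then show ?thesis
    by (rule has_field_derivative_transform_within_open[of _ _ _ \<bbbD>])
      (use z in \<open>auto simp: peak_test_def\<close>)
qed

lemma peak_test_bloch:
  assumes a: "cmod a < 1"
  shows "peak_test a \<in> bloch_space" and "bloch_norm (peak_test a) \<le> 1"
proof -
  have L: "0 < log_weight a" using log_weight_ge_half[OF a] by simp
  have bound: "(1 - (cmod z)\<^sup>2) * cmod (deriv (peak_test a) z) \<le> 8/9" if z: "z \<in> \<bbbD>" for z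
  proof -
    have "(1 - (cmod z)\<^sup>2) * cmod (deriv (peak_test a) z)
      = 2 * (cmod (log_test a z) * ((1 - (cmod z)\<^sup>2) * cmod (deriv (log_test a) z))) / (9 * log_weight a)"
      using L by (simp add: DERIV_imp_deriv[OF peak_test_deriv[OF a z]] norm_divide norm_mult)
    \<comment> \<open>The bound by the weight at \<open>a\<close>, uniform in \<open>z\<close>, cancels the denominator.\<close>
    also have "\<dots> \<le> 2 * ((2 * log_weight a) * 2) / (9 * log_weight a)"
      using log_test_bound_pole[OF a, of z] log_test_deriv_bound[OF a z] disk_weight_nonneg[OF z] z L
      by (intro divide_right_mono mult_left_mono mult_mono) auto
    finally show ?thesis using L by simp
  qed
  have "peak_test a holomorphic_on \<bbbD>"
    using peak_test_deriv[OF a] unfolding holomorphic_on_open[OF open_ball] by blast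
  then show "peak_test a \<in> bloch_space"
    by (intro bloch_spaceI[OF _ _ bound]) (auto simp: peak_test_def)
  have "cmod (peak_test a 0) = (ln 2 * ln 2) / (9 * log_weight a)"
    using L by (simp add: peak_test_def log_test_def norm_divide norm_mult power2_eq_square)
  also have "\<dots> \<le> (1 * log_weight a) / (9 * log_weight a)"
    using L ln_2_le_1 log_weight_ge_ln_2[OF a] by (intro divide_right_mono mult_mono) auto
  finally show "bloch_norm (peak_test a) \<le> 1"
    using L bloch_seminorm_le[OF bound] by (simp add: bloch_norm_def)
qed

lemma peak_test_self:
  assumes "cmod a < 1" shows "peak_test a a = of_real (log_weight a / 9)"
  using assms log_weight_ge_half[OF assms]
  by (simp add: peak_test_def log_test_self power2_eq_square)

lemma log_weight_at_top:
  assumes "\<And>n. cmod (a n) < 1" "(\<lambda>n. cmod (a n)) \<longlonglongrightarrow> 1"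
  shows "filterlim (\<lambda>n. log_weight (a n)) at_top sequentially"
proof -
  have "filterlim (\<lambda>r. ln (2 / (1 - r\<^sup>2))) at_top (at_left (1::real))"
    by real_asymp
  moreover have "filterlim (\<lambda>n. cmod (a n)) (at_left 1) sequentially"
    using assms by (auto simp: filterlim_at intro!: always_eventually less_imp_neq)
  ultimately show ?thesis
    unfolding log_weight_def by (rule filterlim_compose)
qed

lemma peak_test_tendsto_0:
  assumes a: "\<And>n. cmod (a n) < 1" "(\<lambda>n. cmod (a n)) \<longlonglongrightarrow> 1" and z: "cmod z < 1"
  shows "(\<lambda>n. peak_test (a n) z) \<longlonglongrightarrow> 0"
proof (rule Lim_null_comparison)
  show "\<forall>\<^sub>F n in sequentially. cmod (peak_test (a n) z) \<le> (2 * log_weight z)\<^sup>2 / 9 / log_weight (a n)"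
  proof (rule always_eventually, rule allI)
    fix n
    have "(cmod (log_test (a n) z))\<^sup>2 \<le> (2 * log_weight z)\<^sup>2"
      by (intro power_mono log_test_bound_arg a z) auto
    then show "cmod (peak_test (a n) z) \<le> (2 * log_weight z)\<^sup>2 / 9 / log_weight (a n)"
      using z log_weight_ge_half[OF a(1)[of n]]
      by (simp add: peak_test_def norm_divide norm_power divide_right_mono)
  qed
  show "(\<lambda>n. (2 * log_weight z)\<^sup>2 / 9 / log_weight (a n)) \<longlonglongrightarrow> 0"
    by (rule real_tendsto_divide_at_top[OF tendsto_const log_weight_at_top[OF a]])
qed

section \<open>Consequences of boundedness and of compactness\<close>

text \<open>Apply \<open>J\<^sub>g\<close> to \<open>log_test a\<close>, whose norm is at most 3, and evaluate the derivative at \<open>a\<close>.\<close>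

lemma bloch_bounded_volterra_imp_log_bound:
  assumes g: "g holomorphic_on \<bbbD>" and bdd: "bloch_bounded (volterra_op g)"
  obtains C where "\<And>z. z \<in> \<bbbD> \<Longrightarrow> (1 - (cmod z)\<^sup>2) * cmod (deriv g z) * log_weight z \<le> C"
proof -
  obtain K where K: "\<And>f. f \<in> bloch_space \<Longrightarrow> bloch_norm (volterra_op g f) \<le> K * bloch_norm f"
    using bdd unfolding bloch_bounded_def by blast
  have maps: "volterra_op g f \<in> bloch_space" if "f \<in> bloch_space" for f
    using bloch_linear_maps[of "volterra_op g", OF _ that] bdd unfolding bloch_bounded_def by blast
  have "(1 - (cmod a)\<^sup>2) * cmod (deriv g a) * log_weight a \<le> \<bar>K\<bar> * 3" if a: "a \<in> \<bbbD>" for a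
  proof -
    have a1: "cmod a < 1" using a by simp
    note mem = log_test_bloch(1)[OF a1]
    have hol: "log_test a holomorphic_on \<bbbD>" using mem by (simp add: bloch_space_def)
    have "(1 - (cmod a)\<^sup>2) * cmod (deriv g a) * log_weight a
        = (1 - (cmod a)\<^sup>2) * cmod (deriv (volterra_op g (log_test a)) a)"
      using log_weight_ge_half[OF a1]
      by (simp add: deriv_volterra_op[OF g hol a] log_test_self[OF a1] norm_mult)
    also have "\<dots> \<le> bloch_norm (volterra_op g (log_test a))"
      using bloch_seminorm_bound[OF maps[OF mem] a] norm_ge_zero[of "volterra_op g (log_test a) 0"]
      unfolding bloch_norm_def by linarith
    also have "\<dots> \<le> K * bloch_norm (log_test a)"
      by (rule K[OF mem])
    also have "\<dots> \<le> \<bar>K\<bar> * 3"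
      using log_test_bloch(2)[OF a1] bloch_seminorm_nonneg[OF mem]
      by (intro mult_mono) (auto simp: bloch_norm_def)
    finally show ?thesis .
  qed
  then show ?thesis by (rule that)
qed

lemma tendsto_zero_if_subseq:
  fixes X :: "nat \<Rightarrow> real"
  assumes sub: "\<And>r::nat \<Rightarrow> nat. strict_mono r \<Longrightarrow> \<exists>s::nat \<Rightarrow> nat. strict_mono s \<and> (\<lambda>n. X (r (s n))) \<longlonglongrightarrow> 0"
  shows "X \<longlonglongrightarrow> 0"
proof (rule ccontr)
  assume "\<not> X \<longlonglongrightarrow> 0"
  then obtain e where e: "e > 0" and "\<not> eventually (\<lambda>n. dist (X n) 0 < e) sequentially"
    unfolding tendsto_iff by blast
  then have "\<exists>\<^sub>F n in sequentially. e \<le> \<bar>X n\<bar>"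
    by (simp add: frequently_def not_le)
  then have "infinite {n. e \<le> \<bar>X n\<bar>}"
    by (simp add: frequently_cofinite flip: cofinite_eq_sequentially)
  then obtain r :: "nat \<Rightarrow> nat" where r: "strict_mono r" "\<And>n. e \<le> \<bar>X (r n)\<bar>"
    using infinite_enumerate[of "{n. e \<le> \<bar>X n\<bar>}"] by auto
  obtain s :: "nat \<Rightarrow> nat" where "(\<lambda>n. X (r (s n))) \<longlonglongrightarrow> 0"
    using sub[OF r(1)] by blast
  then have "eventually (\<lambda>n. \<bar>X (r (s n))\<bar> < e) sequentially"
    using e by (simp add: tendsto_iff dist_real_def)
  then obtain n where "\<bar>X (r (s n))\<bar> < e"
    unfolding eventually_sequentially by blast
  then show False using r(2)[of "s n"] by simp
qed

text \<open>Along a subsequence the images of \<open>peak_test (\<phi> (z n))\<close> converge in norm. The limit has zero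
  derivative because the images have derivatives tending to zero pointwise, so the seminorms of the
  images tend to zero; the derivative at \<open>z n\<close> then gives the claim.\<close>

lemma compact_commutator_imp_tendsto:
  assumes g: "g holomorphic_on \<bbbD>" and phi: "\<phi> \<in> disk_selfmaps"
    and comp: "bloch_compact (commutator g \<phi>)"
    and z: "\<And>n. z n \<in> \<bbbD>" and lim: "(\<lambda>n. cmod (\<phi> (z n))) \<longlonglongrightarrow> 1"
  shows "(\<lambda>n. (1 - (cmod (z n))\<^sup>2) * log_weight (\<phi> (z n))
            * cmod (deriv \<phi> (z n) * deriv g (\<phi> (z n)) - deriv g (z n))) \<longlonglongrightarrow> 0" (is "?X \<longlonglongrightarrow> 0")
proof (rule tendsto_zero_if_subseq)
  interpret Metric_space bloch_space bloch_dist by (rule Metric_space_bloch)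
  let ?T = "commutator g \<phi>"
  have maps: "?T f \<in> bloch_space" if "f \<in> bloch_space" for f
    using bloch_linear_maps[of ?T, OF _ that] comp unfolding bloch_compact_def by blast
  fix r :: "nat \<Rightarrow> nat" assume r: "strict_mono r"
  define a where "a n = \<phi> (z (r n))" for n
  have a1: "cmod (a n) < 1" for n
    using disk_selfmap_in[OF phi z] by (simp add: a_def)
  have alim: "(\<lambda>n. cmod (a n)) \<longlonglongrightarrow> 1"
    using LIMSEQ_subseq_LIMSEQ[OF lim r] by (simp add: a_def o_def)
  define F where "F n = ?T (peak_test (a n))" for n
  let ?S = "?T ` {f \<in> bloch_space. bloch_norm f \<le> 1}"
  have F: "F n \<in> ?S" for n
    using peak_test_bloch[OF a1] by (auto simp: F_def)
  have "?S \<subseteq> mtopology closure_of ?S"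
    using maps by (intro closure_of_subset) auto
  then have "range F \<subseteq> mtopology closure_of ?S"
    using F by blast
  moreover have "compactin mtopology (mtopology closure_of ?S)"
    using comp unfolding bloch_compact_def bloch_topology_def by blast
  ultimately obtain l s where s: "strict_mono (s :: nat \<Rightarrow> nat)" and lims: "limitin mtopology (F \<circ> s) l sequentially"
    unfolding compactin_sequentially by blast
  then have l: "l \<in> bloch_space" and dist0: "(\<lambda>n. bloch_dist (F (s n)) l) \<longlonglongrightarrow> 0"
    unfolding limitin_metric_dist_null by (auto simp: o_def)
  have Fmem: "F n \<in> bloch_space" for n
    unfolding F_def by (rule maps[OF peak_test_bloch(1)[OF a1]])
  have dF: "deriv (F n) w = peak_test (a n) (\<phi> w) * (deriv \<phi> w * deriv g (\<phi> w) - deriv g w)"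
    if "w \<in> \<bbbD>" for n w
    unfolding F_def
    by (rule deriv_commutator[OF g phi bloch_holomorphic[OF peak_test_bloch(1)[OF a1]] that])
  have dl: "deriv l w = 0" if w: "w \<in> \<bbbD>" for w
  proof -
    have w1: "cmod (\<phi> w) < 1" using disk_selfmap_in[OF phi w] by simp
    \<comment> \<open>At a fixed \<open>w\<close> the test functions vanish in the limit, and norm convergence forces the same limit on \<open>deriv l w\<close>.\<close>
    have "(\<lambda>n. peak_test (a (s n)) (\<phi> w)) \<longlonglongrightarrow> 0"
      using LIMSEQ_subseq_LIMSEQ[OF peak_test_tendsto_0[OF a1 alim w1] s] by (simp add: o_def)
    then have "(\<lambda>n. (1 - (cmod w)\<^sup>2) * cmod (deriv (F (s n)) w - deriv l w))
        \<longlonglongrightarrow> (1 - (cmod w)\<^sup>2) * cmod (0 * (deriv \<phi> w * deriv g (\<phi> w) - deriv g w) - deriv l w)"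
      unfolding dF[OF w] by (intro tendsto_intros)
    moreover have "(\<lambda>n. (1 - (cmod w)\<^sup>2) * cmod (deriv (F (s n)) w - deriv l w)) \<longlonglongrightarrow> 0"
      by (rule tendsto_sandwich[OF _ _ tendsto_const dist0])
        (use bloch_dist_deriv[OF Fmem l w] disk_weight_nonneg[OF w] in \<open>auto intro!: always_eventually mult_nonneg_nonneg\<close>)
    ultimately have "(1 - (cmod w)\<^sup>2) * cmod (0 * (deriv \<phi> w * deriv g (\<phi> w) - deriv g w) - deriv l w) = 0"
      by (rule LIMSEQ_unique)
    then show ?thesis
      using disk_weight_pos[of w] w by simp
  qed
  have le: "?X (r (s n)) \<le> 9 * bloch_dist (F (s n)) l" for n
  proof -
    let ?w = "z (r (s n))"
    have eq: "deriv (F (s n)) ?w = of_real (log_weight (a (s n)) / 9) * (deriv \<phi> ?w * deriv g (\<phi> ?w) - deriv g ?w)"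
      using dF[OF z, of "s n" "r (s n)"] peak_test_self[OF a1, of "s n"] by (simp add: a_def)
    have "cmod (deriv (F (s n)) ?w)
        = log_weight (a (s n)) / 9 * cmod (deriv \<phi> ?w * deriv g (\<phi> ?w) - deriv g ?w)"
      using log_weight_ge_half[OF a1, of "s n"] unfolding eq norm_mult norm_of_real by simp
    then have "?X (r (s n)) = 9 * ((1 - (cmod ?w)\<^sup>2) * cmod (deriv (F (s n)) ?w - deriv l ?w))"
      unfolding dl[OF z] by (simp add: a_def)
    then show ?thesis
      using bloch_dist_deriv[OF Fmem l z, of "r (s n)" "s n"] by linarith
  qed
  have nonneg: "0 \<le> ?X (r (s n))" for n
    using disk_weight_nonneg[OF z] log_weight_ge_half[OF a1, of "s n"]
    by (intro mult_nonneg_nonneg) (auto simp: a_def)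
  have "(\<lambda>n. ?X (r (s n))) \<longlonglongrightarrow> 0"
    by (rule tendsto_sandwich[OF _ _ tendsto_const tendsto_mult_right_zero[OF dist0]])
      (use le nonneg in \<open>auto intro!: always_eventually\<close>)
  then show "\<exists>s::nat \<Rightarrow> nat. strict_mono s \<and> (\<lambda>n. ?X (r (s n))) \<longlonglongrightarrow> 0"
    using s by blast
qed

section \<open>Averaging over rotations\<close>

lemma eventually_disk_boundary:
  "eventually R (filtercomap cmod (at_left 1)) \<longleftrightarrow> (\<exists>b<1. \<forall>z. b < cmod z \<longrightarrow> cmod z < 1 \<longrightarrow> R z)"
proof
  assume "eventually R (filtercomap cmod (at_left 1))"
  then obtain P where P: "eventually P (at_left (1::real))" "\<And>z. P (cmod z) \<Longrightarrow> R z"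
    unfolding eventually_filtercomap by blast
  from P(1) obtain b where "b < 1" "\<And>y. b < y \<Longrightarrow> y < 1 \<Longrightarrow> P y"
    using eventually_at_left[of 0 "1::real" P] by auto
  then show "\<exists>b<1. \<forall>z. b < cmod z \<longrightarrow> cmod z < 1 \<longrightarrow> R z"
    using P(2) by blast
next
  assume "\<exists>b<1. \<forall>z. b < cmod z \<longrightarrow> cmod z < 1 \<longrightarrow> R z"
  then obtain b where b: "b < 1" "\<And>z. b < cmod z \<Longrightarrow> cmod z < 1 \<Longrightarrow> R z" by blast
  have "eventually (\<lambda>y. b < y \<and> y < 1) (at_left (1::real))"
    using eventually_at_left[of 0 "1::real"] b(1) by auto
  then show "eventually R (filtercomap cmod (at_left 1))"
    unfolding eventually_filtercomap using b(2) by blast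
qed

lemma tendsto_disk_boundary_sequentially:
  fixes Q :: "complex \<Rightarrow> real"
  assumes seq: "\<And>z. (\<And>n::nat. z n \<in> \<bbbD>) \<Longrightarrow> (\<lambda>n. cmod (z n)) \<longlonglongrightarrow> 1 \<Longrightarrow> (\<lambda>n. Q (z n)) \<longlonglongrightarrow> 0"
  shows "(Q \<longlongrightarrow> 0) (filtercomap cmod (at_left 1))"
proof (rule ccontr)
  assume "\<not> (Q \<longlongrightarrow> 0) (filtercomap cmod (at_left 1))"
  then obtain e where e: "e > 0"
    and "\<not> eventually (\<lambda>z. dist (Q z) 0 < e) (filtercomap cmod (at_left 1))"
    unfolding tendsto_iff by blast
  then have ex: "\<exists>z. b < cmod z \<and> cmod z < 1 \<and> \<not> dist (Q z) 0 < e" if "b < 1" for b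
    using that unfolding eventually_disk_boundary by blast
  have "\<exists>z. 1 - 1 / real (Suc n) < cmod z \<and> cmod z < 1 \<and> \<not> dist (Q z) 0 < e" for n
    by (rule ex) simp
  then obtain z where z: "\<And>n. 1 - 1 / real (Suc n) < cmod (z n)" "\<And>n. cmod (z n) < 1"
      "\<And>n. \<not> dist (Q (z n)) 0 < e"
    by metis
  have lower: "(\<lambda>n. 1 - 1 / real (Suc n)) \<longlonglongrightarrow> 1"
    using tendsto_diff[OF tendsto_const[of 1] LIMSEQ_Suc[OF lim_1_over_n]] by simp
  have "(\<lambda>n. cmod (z n)) \<longlonglongrightarrow> 1"
    by (rule tendsto_sandwich[OF _ _ lower tendsto_const])
      (use z in \<open>auto intro!: always_eventually less_imp_le\<close>)
  then have "(\<lambda>n. Q (z n)) \<longlonglongrightarrow> 0"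
    using z(2) by (intro seq) auto
  then have "eventually (\<lambda>n. dist (Q (z n)) 0 < e) sequentially"
    using e unfolding tendsto_iff by blast
  then show False
    using z(3) by simp
qed

lemma rotation_selfmap: "cmod u = 1 \<Longrightarrow> (\<lambda>z. u * z) \<in> disk_selfmaps"
  by (auto simp: disk_selfmaps_def norm_mult intro!: holomorphic_intros)

definition circle_point :: "real \<Rightarrow> complex"
  where "circle_point t = exp (2 * of_real pi * \<i> * of_real t)"

lemma cmod_circle_point [simp]: "cmod (circle_point t) = 1"
  by (simp add: circle_point_def)

text \<open>Up to the factor \<open>2 * pi * \<i> * z\<close>, the integrand is the derivative of the closed curve
  \<open>t \<mapsto> g (circle_point t * z)\<close>.\<close>

lemma circle_mean_deriv:
  assumes g: "g holomorphic_on \<bbbD>" and z: "z \<in> \<bbbD>" and nz: "z \<noteq> 0"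
  shows "((\<lambda>t. circle_point t * deriv g (circle_point t * z)) has_integral 0) {0..1}"
proof -
  let ?c = "2 * of_real pi * \<i>"
  have "((\<lambda>t. ?c * z * (circle_point t * deriv g (circle_point t * z))) has_integral
      g (circle_point 1 * z) - g (circle_point 0 * z)) {0..1}"
  proof (rule fundamental_theorem_of_calculus)
    fix t :: real
    have "(g has_field_derivative deriv g (circle_point t * z)) (at (exp (?c * of_real t) * z))"
      using z holomorphic_derivI[OF g, of "circle_point t * z"]
      by (simp add: circle_point_def norm_mult)
    moreover have "((\<lambda>w. exp (?c * w) * z) has_field_derivative ?c * z * circle_point t) (at (of_real t))"
      by (auto intro!: derivative_eq_intros simp: circle_point_def)
    ultimately have "((\<lambda>w. g (exp (?c * w) * z)) has_field_derivative
        deriv g (circle_point t * z) * (?c * z * circle_point t)) (at (of_real t))"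
      by (rule DERIV_chain2)
    then have "((\<lambda>t. g (exp (?c * of_real t) * z)) has_vector_derivative
        deriv g (circle_point t * z) * (?c * z * circle_point t)) (at t within {0..1})"
      by (rule has_vector_derivative_real_field)
    then show "((\<lambda>t. g (circle_point t * z)) has_vector_derivative
        ?c * z * (circle_point t * deriv g (circle_point t * z))) (at t within {0..1})"
      by (simp add: circle_point_def mult_ac)
  qed simp
  moreover have "circle_point 1 = 1" "circle_point 0 = 1"
    by (simp_all add: circle_point_def exp_two_pi_i)
  ultimately have "((\<lambda>t. ?c * z * (circle_point t * deriv g (circle_point t * z))) has_integral 0) {0..1}"
    by simp
  from has_integral_mult_right[OF this, of "1 / (?c * z)"] show ?thesis
    using nz by simp
qed

text \<open>Average over \<open>u\<close>: the rotated term has mean zero, so the mean of the differences is \<open>- g' (z n)\<close>.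
  The differences converge only pointwise in \<open>u\<close>; the bound \<open>C\<close> provides the majorant for dominated
  convergence.\<close>

lemma rotation_differences_imp_tendsto:
  assumes g: "g holomorphic_on \<bbbD>"
    and C: "\<And>z. z \<in> \<bbbD> \<Longrightarrow> (1 - (cmod z)\<^sup>2) * cmod (deriv g z) * log_weight z \<le> C"
    and z: "\<And>n. z n \<in> \<bbbD>" and lim: "(\<lambda>n. cmod (z n)) \<longlonglongrightarrow> 1"
    and rot: "\<And>u. cmod u = 1 \<Longrightarrow>
      (\<lambda>n. (1 - (cmod (z n))\<^sup>2) * log_weight (z n) * cmod (u * deriv g (u * z n) - deriv g (z n))) \<longlonglongrightarrow> 0"
  shows "(\<lambda>n. (1 - (cmod (z n))\<^sup>2) * cmod (deriv g (z n)) * log_weight (z n)) \<longlonglongrightarrow> 0"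
proof -
  define W where "W w = (1 - (cmod w)\<^sup>2) * log_weight w" for w
  have Wpos: "0 \<le> W w" if "w \<in> \<bbbD>" for w
    using that disk_weight_nonneg[OF that] log_weight_ge_half[of w] by (simp add: W_def)
  have Wrot: "W (u * w) = W w" if "cmod u = 1" for u w
    using that by (simp add: W_def log_weight_def norm_mult)
  have WC: "W w * cmod (deriv g w) \<le> C" if "w \<in> \<bbbD>" for w
    using C[OF that] by (simp add: W_def mult_ac)
  have in_disk: "circle_point t * z n \<in> \<bbbD>" for t n
    using z[of n] by (simp add: norm_mult)
  define f where "f n t = of_real (W (z n)) * (circle_point t * deriv g (circle_point t * z n) - deriv g (z n))" for n t
  have cont: "continuous_on {0..1} circle_point"
    unfolding circle_point_def by (intro continuous_intros)
  have "continuous_on {0..1} (\<lambda>t. deriv g (circle_point t * z n))" for n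
  proof (rule continuous_on_compose2[of \<bbbD> "deriv g"])
    show "continuous_on \<bbbD> (deriv g)"
      by (intro holomorphic_on_imp_continuous_on holomorphic_deriv g open_ball)
    show "continuous_on {0..1} (\<lambda>t. circle_point t * z n)"
      by (intro continuous_intros cont)
    show "(\<lambda>t. circle_point t * z n) ` {0..1} \<subseteq> \<bbbD>"
      using in_disk by blast
  qed
  then have integrable: "f n integrable_on {0..1}" for n
    unfolding f_def by (intro integrable_continuous_real continuous_intros cont)
  have bound: "cmod (f n t) \<le> 2 * C" for n t
  proof -
    have "cmod (f n t) \<le> W (z n) * (cmod (deriv g (circle_point t * z n)) + cmod (deriv g (z n)))"
      using Wpos[OF z, of n] norm_triangle_ineq4[of "circle_point t * deriv g (circle_point t * z n)" "deriv g (z n)"]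
      by (simp add: f_def norm_mult mult_left_mono)
    also have "\<dots> = W (circle_point t * z n) * cmod (deriv g (circle_point t * z n)) + W (z n) * cmod (deriv g (z n))"
      by (simp add: Wrot distrib_left)
    also have "\<dots> \<le> 2 * C"
      using WC[OF z, of n] WC[OF in_disk, of t n] by simp
    finally show ?thesis .
  qed
  have pointwise: "(\<lambda>n. f n t) \<longlonglongrightarrow> 0" for t
  proof (rule tendsto_norm_zero_cancel)
    have "cmod (f n t) = (1 - (cmod (z n))\<^sup>2) * log_weight (z n)
        * cmod (circle_point t * deriv g (circle_point t * z n) - deriv g (z n))" for n
      using Wpos[OF z, of n] unfolding f_def norm_mult norm_of_real by (simp add: W_def)
    then show "(\<lambda>n. cmod (f n t)) \<longlonglongrightarrow> 0"
      using rot[of "circle_point t"] by simp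
  qed
  have "(\<lambda>n. integral {0..1} (f n)) \<longlonglongrightarrow> integral {0..1} (\<lambda>t::real. 0)"
    by (rule dominated_convergence(2)[where h = "\<lambda>_. 2 * C"]) (use integrable bound pointwise in auto)
  moreover have "eventually (\<lambda>n. integral {0..1} (f n) = - (of_real (W (z n)) * deriv g (z n))) sequentially"
  proof -
    \<comment> \<open>The mean-value identity divides by \<open>z n\<close>, so the origin has to be avoided.\<close>
    have "eventually (\<lambda>n. 0 < cmod (z n)) sequentially"
      using lim by (rule order_tendstoD) simp
    then show ?thesis
    proof eventually_elim
      case (elim n)
      then have nz: "z n \<noteq> 0" by simp
      have "((\<lambda>t. of_real (W (z n)) * (circle_point t * deriv g (circle_point t * z n) - deriv g (z n)))
          has_integral of_real (W (z n)) * (0 - deriv g (z n))) {0..1}"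
        using has_integral_const_real[of "deriv g (z n)" 0 1]
        by (intro has_integral_mult_right has_integral_diff circle_mean_deriv[OF g z nz]) simp
      from integral_unique[OF this] show ?case
        unfolding f_def by (simp only: diff_0 mult_minus_right)
    qed
  qed
  ultimately have "(\<lambda>n. - (of_real (W (z n)) * deriv g (z n))) \<longlonglongrightarrow> 0"
    by (simp add: tendsto_cong)
  then have "(\<lambda>n. cmod (- (of_real (W (z n)) * deriv g (z n)))) \<longlonglongrightarrow> 0"
    by (rule tendsto_norm_zero)
  moreover have "cmod (- (of_real (W (z n)) * deriv g (z n)))
      = (1 - (cmod (z n))\<^sup>2) * cmod (deriv g (z n)) * log_weight (z n)" for n
    using Wpos[OF z, of n] unfolding norm_minus_cancel norm_mult norm_of_real by (simp add: W_def)
  ultimately show ?thesis by simp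
qed

lemma commutators_compact_imp_little_o:
  assumes g: "g holomorphic_on \<bbbD>" and bdd: "bloch_bounded (volterra_op g)"
    and comp: "\<And>u. cmod u = 1 \<Longrightarrow> bloch_compact (commutator g (\<lambda>z. u * z))"
  shows "((\<lambda>z. (1 - (cmod z)\<^sup>2) * cmod (deriv g z) * log_weight z) \<longlongrightarrow> 0) (filtercomap cmod (at_left 1))"
proof (rule tendsto_disk_boundary_sequentially)
  fix z :: "nat \<Rightarrow> complex"
  assume z: "\<And>n. z n \<in> \<bbbD>" and lim: "(\<lambda>n. cmod (z n)) \<longlonglongrightarrow> 1"
  obtain C where C: "\<And>z. z \<in> \<bbbD> \<Longrightarrow> (1 - (cmod z)\<^sup>2) * cmod (deriv g z) * log_weight z \<le> C"
    by (rule bloch_bounded_volterra_imp_log_bound[OF g bdd]) blast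
  show "(\<lambda>n. (1 - (cmod (z n))\<^sup>2) * cmod (deriv g (z n)) * log_weight (z n)) \<longlonglongrightarrow> 0"
  proof (rule rotation_differences_imp_tendsto[OF g C z lim])
    fix u :: complex assume u: "cmod u = 1"
    have "log_weight (u * w) = log_weight w" for w
      using u by (simp add: log_weight_def norm_mult)
    moreover have "deriv (\<lambda>z. u * z) w = u" for w
      by (rule DERIV_imp_deriv) (auto intro!: derivative_eq_intros)
    moreover have "(\<lambda>n. cmod (u * z n)) \<longlonglongrightarrow> 1"
      using lim u by (simp add: norm_mult)
    ultimately show "(\<lambda>n. (1 - (cmod (z n))\<^sup>2) * log_weight (z n)
        * cmod (u * deriv g (u * z n) - deriv g (z n))) \<longlonglongrightarrow> 0"
      using compact_commutator_imp_tendsto[OF g rotation_selfmap[OF u] comp[OF u] z] by simp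
  qed
qed

section \<open>Compactness of the commutators\<close>

text \<open>A relatively compact image only needs convergent subsequences of images of sequences from the
  unit ball, with limits anywhere in the space. By Bolzano-Weierstrass, injective sequences suffice,
  and for those at most one term equals the limit.\<close>

lemma bloch_compactI:
  assumes T: "bloch_linear T"
    and sub: "\<And>f::nat \<Rightarrow> complex \<Rightarrow> complex. (\<And>n. f n \<in> bloch_space) \<Longrightarrow> (\<And>n. bloch_norm (f n) \<le> 1) \<Longrightarrow>
      \<exists>l r. l \<in> bloch_space \<and> strict_mono (r :: nat \<Rightarrow> nat) \<and> (\<lambda>n. bloch_dist (T (f (r n))) l) \<longlonglongrightarrow> 0"
  shows "bloch_compact T"
proof -
  interpret Metric_space bloch_space bloch_dist by (rule Metric_space_bloch)
  let ?U = "{f \<in> bloch_space. bloch_norm f \<le> 1}"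
  have "mtopology derived_set_of A \<noteq> {}" if A: "infinite A" "A \<subseteq> T ` ?U" for A
  proof -
    obtain \<sigma> :: "nat \<Rightarrow> complex \<Rightarrow> complex" where \<sigma>: "inj \<sigma>" "range \<sigma> \<subseteq> A"
      using infinite_countable_subset[OF A(1)] by blast
    have "\<exists>f. f \<in> ?U \<and> \<sigma> n = T f" for n
      using \<sigma>(2) A(2) by blast
    then obtain f where f: "\<And>n. f n \<in> ?U" "\<And>n. \<sigma> n = T (f n)" by metis
    obtain l r where l: "l \<in> bloch_space" and r: "strict_mono (r :: nat \<Rightarrow> nat)"
      and lim: "(\<lambda>n. bloch_dist (\<sigma> (r n)) l) \<longlonglongrightarrow> 0"
      using sub[of f] f by auto
    have "\<exists>y\<in>A. y \<noteq> l \<and> y \<in> mball l e" if e: "0 < e" for e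
    proof -
      have "eventually (\<lambda>n. bloch_dist (\<sigma> (r n)) l < e) sequentially"
        using lim e by (rule order_tendstoD)
      then obtain N where N: "\<And>n. N \<le> n \<Longrightarrow> bloch_dist (\<sigma> (r n)) l < e"
        unfolding eventually_sequentially by blast
      have "r N \<noteq> r (Suc N)"
        using r by (simp add: strict_mono_eq)
      then have "\<sigma> (r N) \<noteq> \<sigma> (r (Suc N))"
        using \<sigma>(1) by (simp add: inj_eq)
      then obtain n where n: "N \<le> n" "\<sigma> (r n) \<noteq> l"
        using le_SucI by blast
      have "\<sigma> (r n) \<in> bloch_space"
        using f bloch_linear_maps[OF T] by auto
      then show ?thesis
        using n N[of n] l \<sigma>(2) commute by (intro bexI[of _ "\<sigma> (r n)"]) auto
    qed
    then show ?thesis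
      using l unfolding metric_derived_set_of by blast
  qed
  then show ?thesis
    unfolding bloch_compact_def bloch_topology_def
    using T compact_closure_of_eq_Bolzano_Weierstrass by blast
qed

lemma bloch_locally_bounded:
  assumes K: "compact K" "K \<subseteq> \<bbbD>"
  obtains B where "0 < B" "\<And>f z. f \<in> bloch_space \<Longrightarrow> z \<in> K \<Longrightarrow> cmod (f z) \<le> B * bloch_norm f"
proof -
  have "continuous_on K log_weight"
    unfolding log_weight_def using K(2) disk_weight_pos
    by (intro continuous_intros) (force simp: subset_iff)+
  then have "bounded (log_weight ` K)"
    using K(1) compact_continuous_image compact_imp_bounded by blast
  then obtain B where B: "0 < B" "\<And>z. z \<in> K \<Longrightarrow> \<bar>log_weight z\<bar> \<le> B"
    unfolding bounded_pos by auto
  show thesis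
  proof (rule that[of "2 * B"])
    fix f z assume f: "f \<in> bloch_space" and z: "z \<in> K"
    have "cmod (f z) \<le> 2 * bloch_norm f * log_weight z"
      using bloch_growth[OF f] K(2) z by blast
    also have "\<dots> \<le> 2 * bloch_norm f * B"
      using B(2)[OF z] bloch_norm_nonneg[OF f] by (intro mult_left_mono) auto
    finally show "cmod (f z) \<le> 2 * B * bloch_norm f" by (simp add: mult_ac)
  qed (use B in simp)
qed

text \<open>Bloch balls are normal families by the growth estimate. The seminorm bound survives in the limit
  because derivatives converge pointwise as well.\<close>

lemma bloch_ball_Montel:
  fixes f :: "nat \<Rightarrow> complex \<Rightarrow> complex"
  assumes f: "\<And>n. f n \<in> bloch_space" and norm: "\<And>n. bloch_norm (f n) \<le> M"
  obtains l r where "l \<in> bloch_space" "strict_mono (r :: nat \<Rightarrow> nat)"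
    "\<And>K. compact K \<Longrightarrow> K \<subseteq> \<bbbD> \<Longrightarrow> uniform_limit K (\<lambda>n. f (r n)) l sequentially"
proof -
  have bdd: "\<exists>B. \<forall>h\<in>range f. \<forall>z\<in>K. cmod (h z) \<le> B" if K: "compact K" "K \<subseteq> \<bbbD>" for K
  proof -
    obtain B where B: "0 < B" "\<And>f z. f \<in> bloch_space \<Longrightarrow> z \<in> K \<Longrightarrow> cmod (f z) \<le> B * bloch_norm f"
      by (rule bloch_locally_bounded[OF K]) blast
    have "cmod (f n z) \<le> B * M" if "z \<in> K" for n z
      using B(2)[OF f that, of n] mult_left_mono[OF norm[of n], of B] B(1) by linarith
    then show ?thesis by blast
  qed
  obtain l0 r where l0: "l0 holomorphic_on \<bbbD>" and r: "strict_mono (r :: nat \<Rightarrow> nat)"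
    and unif0: "\<And>K. compact K \<Longrightarrow> K \<subseteq> \<bbbD> \<Longrightarrow> uniform_limit K (f \<circ> r) l0 sequentially"
    by (rule Montel[of \<bbbD> "range f" f]) (use f bdd bloch_holomorphic in auto)
  define l where "l = restrict l0 \<bbbD>"
  have l: "l holomorphic_on \<bbbD>"
    unfolding l_def by (rule restrict_holomorphic[OF l0])
  have unif: "uniform_limit K (\<lambda>n. f (r n)) l sequentially" if K: "compact K" "K \<subseteq> \<bbbD>" for K
  proof -
    have "uniform_limit K (\<lambda>n. f (r n)) l0 sequentially"
      using unif0[OF K] by (simp add: o_def)
    then show ?thesis
      by (rule uniform_limit_cong'[THEN iffD1, rotated 2]) (use K in \<open>auto simp: l_def subset_iff\<close>)
  qed
  have "(1 - (cmod z)\<^sup>2) * cmod (deriv l z) \<le> M" if z: "z \<in> \<bbbD>" for z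
  proof -
    \<comment> \<open>Convergence of derivatives needs uniform convergence on an open neighbourhood of the point.\<close>
    obtain \<rho> where \<rho>: "cmod z < \<rho>" "\<rho> < 1"
      using dense[of "cmod z" 1] z by auto
    have sub: "cball 0 \<rho> \<subseteq> \<bbbD>" using \<rho> by auto
    have "uniform_limit (ball 0 \<rho>) (\<lambda>n. f (r n)) l sequentially"
      using unif[OF compact_cball sub] by (rule uniform_limit_on_subset) auto
    moreover have "f (r n) holomorphic_on ball 0 \<rho>" for n
      using bloch_holomorphic[OF f] by (rule holomorphic_on_subset) (use \<rho> in auto)
    ultimately have "(\<lambda>n. deriv (f (r n)) z) \<longlonglongrightarrow> deriv l z"
      by (intro deriv_complex_uniform_limit[where A = "ball 0 \<rho>"]) (use \<rho> in auto)
    then have "(\<lambda>n. (1 - (cmod z)\<^sup>2) * cmod (deriv (f (r n)) z)) \<longlonglongrightarrow> (1 - (cmod z)\<^sup>2) * cmod (deriv l z)"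
      by (intro tendsto_intros)
    moreover have "(1 - (cmod z)\<^sup>2) * cmod (deriv (f n) z) \<le> M" for n
      using bloch_seminorm_bound[OF f z, of n] norm[of n] norm_ge_zero[of "f n 0"]
      unfolding bloch_norm_def by linarith
    ultimately show ?thesis
      by (intro Lim_bounded) auto
  qed
  then have "l \<in> bloch_space"
    by (intro bloch_spaceI l) (auto simp: l_def)
  then show ?thesis
    by (rule that[OF _ r unif])
qed

text \<open>The seminorm of \<open>J\<^sub>g (d n)\<close> is the supremum of \<open>(1 - \<bar>z\<bar>\<^sup>2) \<bar>d n z\<bar> \<bar>g' z\<bar>\<close>. Near the circle the growth
  estimate for \<open>d n\<close> meets the little-o condition; on the remaining compact disk \<open>g'\<close> is bounded and
  \<open>d n\<close> tends to zero uniformly.\<close>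

lemma volterra_null_sequence:
  fixes d :: "nat \<Rightarrow> complex \<Rightarrow> complex"
  assumes g: "g holomorphic_on \<bbbD>"
    and maps: "\<And>f. f \<in> bloch_space \<Longrightarrow> volterra_op g f \<in> bloch_space"
    and lo: "((\<lambda>z. (1 - (cmod z)\<^sup>2) * cmod (deriv g z) * log_weight z) \<longlongrightarrow> 0) (filtercomap cmod (at_left 1))"
    and d: "\<And>n. d n \<in> bloch_space" and M: "\<And>n. bloch_norm (d n) \<le> M"
    and unif: "\<And>K. compact K \<Longrightarrow> K \<subseteq> \<bbbD> \<Longrightarrow> uniform_limit K d (\<lambda>_. 0) sequentially"
  shows "(\<lambda>n. bloch_norm (volterra_op g (d n))) \<longlonglongrightarrow> 0"
proof (rule LIMSEQ_I)
  fix e :: real assume e: "0 < e"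
  have M0: "0 \<le> M" using bloch_norm_nonneg[OF d, of 0] M[of 0] by linarith
  \<comment> \<open>Chosen so that \<open>2 * (M + 1) * \<epsilon> = e / 2\<close>; adding 1 covers \<open>M = 0\<close>.\<close>
  define \<epsilon> where "\<epsilon> = e / (4 * (M + 1))"
  have \<epsilon>: "0 < \<epsilon>" using e M0 by (simp add: \<epsilon>_def)
  obtain b where b: "b < 1"
    and near: "\<And>z. b < cmod z \<Longrightarrow> cmod z < 1 \<Longrightarrow> \<bar>(1 - (cmod z)\<^sup>2) * cmod (deriv g z) * log_weight z\<bar> < \<epsilon>"
    using lo \<epsilon> unfolding tendsto_iff eventually_disk_boundary by (auto simp: dist_real_def)
  have sub: "cball 0 b \<subseteq> \<bbbD>" using b by auto
  have "continuous_on (cball 0 b) (deriv g)"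
    using holomorphic_on_imp_continuous_on[OF holomorphic_deriv[OF g open_ball]] sub
    by (rule continuous_on_subset)
  then have "bounded (deriv g ` cball 0 b)"
    by (intro compact_imp_bounded compact_continuous_image compact_cball)
  then obtain C where C: "0 < C" "\<And>z. z \<in> cball 0 b \<Longrightarrow> cmod (deriv g z) \<le> C"
    unfolding bounded_pos by auto
  have "0 < e / (2 * C)" using e C by simp
  then obtain N where N: "\<And>n z. N \<le> n \<Longrightarrow> z \<in> cball 0 b \<Longrightarrow> cmod (d n z) < e / (2 * C)"
    using uniform_limitD[OF unif[OF compact_cball sub]] unfolding eventually_sequentially
    by (metis dist_0_norm dist_commute)
  have "\<bar>bloch_norm (volterra_op g (d n))\<bar> < e" if n: "N \<le> n" for n
  proof -
    have "(1 - (cmod z)\<^sup>2) * cmod (deriv (volterra_op g (d n)) z) \<le> e / 2" if z: "z \<in> \<bbbD>" for z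
    proof (cases "cmod z \<le> b")
      case True
      then have zb: "z \<in> cball 0 b" by simp
      have "(1 - (cmod z)\<^sup>2) * (cmod (d n z) * cmod (deriv g z)) \<le> 1 * (e / (2 * C) * C)"
        using N[OF n zb] C(2)[OF zb] C(1) e disk_weight_nonneg[OF z] by (intro mult_mono) auto
      also have "\<dots> = e / 2" using C(1) by simp
      finally show ?thesis
        by (simp add: deriv_volterra_op[OF g bloch_holomorphic[OF d] z] norm_mult)
    next
      case False
      let ?q = "(1 - (cmod z)\<^sup>2) * cmod (deriv g z)"
      have q: "0 \<le> ?q" using disk_weight_nonneg[OF z] by simp
      have "(1 - (cmod z)\<^sup>2) * (cmod (d n z) * cmod (deriv g z)) = ?q * cmod (d n z)"
        by (simp add: mult_ac)
      also have "\<dots> \<le> ?q * (2 * bloch_norm (d n) * log_weight z)"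
        by (intro mult_left_mono bloch_growth d z q)
      also have "\<dots> = 2 * bloch_norm (d n) * (?q * log_weight z)"
        by (simp add: mult_ac)
      also have "\<dots> \<le> 2 * M * \<epsilon>"
        using near[of z] False z M[of n] bloch_norm_nonneg[OF d, of n] q log_weight_ge_half[of z] M0
        by (intro mult_mono) auto
      also have "\<dots> \<le> 2 * (M + 1) * \<epsilon>"
        using \<epsilon> by simp
      also have "\<dots> = e / 2"
        using M0 by (simp add: \<epsilon>_def field_simps)
      finally show ?thesis
        by (simp add: deriv_volterra_op[OF g bloch_holomorphic[OF d] z] norm_mult)
    qed
    then have "bloch_seminorm (volterra_op g (d n)) \<le> e / 2"
      by (rule bloch_seminorm_le)
    then have "bloch_norm (volterra_op g (d n)) \<le> e / 2"
      by (simp add: bloch_norm_def volterra_op_0)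
    then show ?thesis
      using e bloch_norm_nonneg[OF maps[OF d], of n] by simp
  qed
  then show "\<exists>N. \<forall>n\<ge>N. norm (bloch_norm (volterra_op g (d n)) - 0) < e"
    by auto
qed

text \<open>Subtract the locally uniform limit of a subsequence of the unit ball. Each of the two products
  maps the differences to a norm null sequence: for \<open>C J\<close> the outer factor is bounded, and for \<open>J C\<close>
  the inner factor preserves boundedness and locally uniform convergence to zero.\<close>

lemma little_o_imp_commutator_compact:
  assumes g: "g holomorphic_on \<bbbD>" and lin: "bloch_linear (volterra_op g)"
    and lo: "((\<lambda>z. (1 - (cmod z)\<^sup>2) * cmod (deriv g z) * log_weight z) \<longlongrightarrow> 0) (filtercomap cmod (at_left 1))"
    and phi: "\<phi> \<in> disk_selfmaps"
  shows "bloch_compact (commutator g \<phi>)"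
proof (rule bloch_compactI)
  let ?J = "volterra_op g" and ?C = "composition_op \<phi>"
  note linC = bloch_linear_composition_op[OF phi]
  note mapsJ = bloch_linear_maps[OF lin] and mapsC = bloch_linear_maps[OF linC]
  show linT: "bloch_linear (commutator g \<phi>)"
    by (intro bloch_linear_op_diff bloch_linear_comp lin linC)
  fix f :: "nat \<Rightarrow> complex \<Rightarrow> complex"
  assume f: "\<And>n. f n \<in> bloch_space" and norm: "\<And>n. bloch_norm (f n) \<le> 1"
  obtain l r where l: "l \<in> bloch_space" and r: "strict_mono (r :: nat \<Rightarrow> nat)"
    and unif: "\<And>K. compact K \<Longrightarrow> K \<subseteq> \<bbbD> \<Longrightarrow> uniform_limit K (\<lambda>n. f (r n)) l sequentially"
    by (rule bloch_ball_Montel[of f 1, OF f norm]) blast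
  define d where "d n = (\<lambda>z\<in>\<bbbD>. f (r n) z - l z)" for n
  have d: "d n \<in> bloch_space" for n
    unfolding d_def by (rule bloch_space_diff[OF f l])
  have dnorm: "bloch_norm (d n) \<le> 1 + bloch_norm l" for n
    using bloch_norm_diff_le[OF f l, of "r n"] norm[of "r n"] by (simp add: d_def)
  have dunif: "uniform_limit K d (\<lambda>_. 0) sequentially" if K: "compact K" "K \<subseteq> \<bbbD>" for K
  proof (rule uniform_limitI)
    fix e :: real assume "0 < e"
    then have "eventually (\<lambda>n. \<forall>z\<in>K. dist (f (r n) z) (l z) < e) sequentially"
      using unif[OF K] by (rule uniform_limitD[rotated])
    then show "eventually (\<lambda>n. \<forall>z\<in>K. dist (d n z) 0 < e) sequentially"
      by eventually_elim (use K(2) in \<open>auto simp: d_def dist_norm subset_iff\<close>)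
  qed
  let ?B = "2 * log_weight (\<phi> 0) + 1"
  have B: "0 \<le> ?B"
    using log_weight_ge_half[of "\<phi> 0"] disk_selfmap_in[OF phi, of 0] by simp
  have "bloch_norm (?C (d n)) \<le> ?B * (1 + bloch_norm l)" for n
    using bloch_norm_composition_op[OF phi d, of n] mult_left_mono[OF dnorm B, of n] by linarith
  moreover have "uniform_limit K (\<lambda>n. ?C (d n)) (\<lambda>_. 0) sequentially" if K: "compact K" "K \<subseteq> \<bbbD>" for K
  proof (rule uniform_limitI)
    fix e :: real assume e: "0 < e"
    have "continuous_on K \<phi>"
      using phi K(2) holomorphic_on_imp_continuous_on continuous_on_subset
      unfolding disk_selfmaps_def by blast
    then have "compact (\<phi> ` K)"
      using K(1) by (rule compact_continuous_image)
    moreover have "\<phi> ` K \<subseteq> \<bbbD>"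
      using disk_selfmap_in[OF phi] K(2) by blast
    ultimately have "eventually (\<lambda>n. \<forall>z\<in>\<phi> ` K. dist (d n z) 0 < e) sequentially"
      using dunif e by (intro uniform_limitD)
    then show "eventually (\<lambda>n. \<forall>z\<in>K. dist (?C (d n) z) 0 < e) sequentially"
      by eventually_elim (use K(2) in \<open>auto simp: composition_op_def subset_iff\<close>)
  qed
  ultimately have JC: "(\<lambda>n. bloch_norm (?J (?C (d n)))) \<longlonglongrightarrow> 0"
    by (intro volterra_null_sequence[OF g mapsJ lo]) (auto intro: mapsC d)
  have J: "(\<lambda>n. bloch_norm (?J (d n))) \<longlonglongrightarrow> 0"
    by (rule volterra_null_sequence[OF g mapsJ lo d dnorm dunif])
  have dist_le: "bloch_dist (commutator g \<phi> (f (r n))) (commutator g \<phi> l)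
      \<le> ?B * bloch_norm (?J (d n)) + bloch_norm (?J (?C (d n)))" for n
  proof -
    have "bloch_dist (commutator g \<phi> (f (r n))) (commutator g \<phi> l) = bloch_norm (commutator g \<phi> (d n))"
      using bloch_linear_diff[OF linT f l, of "r n"] bloch_linear_maps[OF linT] f l
      by (simp add: bloch_dist_def d_def)
    also have "\<dots> \<le> bloch_norm (?C (?J (d n))) + bloch_norm (?J (?C (d n)))"
      using bloch_norm_diff_le[OF mapsC[OF mapsJ[OF d]] mapsJ[OF mapsC[OF d]], of n n]
      by (simp add: op_diff_def)
    also have "bloch_norm (?C (?J (d n))) \<le> ?B * bloch_norm (?J (d n))"
      by (rule bloch_norm_composition_op[OF phi mapsJ[OF d]])
    finally show ?thesis by simp
  qed
  have bound_lim: "(\<lambda>n. ?B * bloch_norm (?J (d n)) + bloch_norm (?J (?C (d n)))) \<longlonglongrightarrow> 0"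
    using tendsto_add[OF tendsto_mult_right_zero[OF J, of ?B] JC] by simp
  have "(\<lambda>n. bloch_dist (commutator g \<phi> (f (r n))) (commutator g \<phi> l)) \<longlonglongrightarrow> 0"
  proof (rule tendsto_sandwich[OF _ _ tendsto_const bound_lim]; rule always_eventually; rule allI)
    fix n
    show "0 \<le> bloch_dist (commutator g \<phi> (f (r n))) (commutator g \<phi> l)"
      by (rule Metric_space.nonneg[OF Metric_space_bloch])
    show "bloch_dist (commutator g \<phi> (f (r n))) (commutator g \<phi> l)
        \<le> ?B * bloch_norm (?J (d n)) + bloch_norm (?J (?C (d n)))"
      by (rule dist_le)
  qed
  then show "\<exists>l r. l \<in> bloch_space \<and> strict_mono (r :: nat \<Rightarrow> nat)
      \<and> (\<lambda>n. bloch_dist (commutator g \<phi> (f (r n))) l) \<longlonglongrightarrow> 0"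
    using bloch_linear_maps[OF linT l] r
    by (intro exI[of _ "commutator g \<phi> l"] exI[of _ r] conjI)
qed

theorem theorem4p11:
  fixes g :: "complex \<Rightarrow> complex"
  assumes "g holomorphic_on \<bbbD>"
    and "bloch_bounded (volterra_op g)"
  shows "(\<forall>\<phi>\<in>disk_selfmaps.
            bloch_compact (op_diff (composition_op \<phi> \<circ> volterra_op g) (volterra_op g \<circ> composition_op \<phi>)))
     \<longleftrightarrow> ((\<lambda>z. (1 - (cmod z)\<^sup>2) * cmod (deriv g z) * ln (2 / (1 - (cmod z)\<^sup>2))) \<longlongrightarrow> 0)
           (filtercomap cmod (at_left 1))"
  unfolding log_weight_def[symmetric]
proof
  assume "\<forall>\<phi>\<in>disk_selfmaps. bloch_compact (commutator g \<phi>)"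
  then show "((\<lambda>z. (1 - (cmod z)\<^sup>2) * cmod (deriv g z) * log_weight z) \<longlongrightarrow> 0)
      (filtercomap cmod (at_left 1))"
    by (intro commutators_compact_imp_little_o[OF assms]) (simp add: rotation_selfmap)
next
  assume lo: "((\<lambda>z. (1 - (cmod z)\<^sup>2) * cmod (deriv g z) * log_weight z) \<longlongrightarrow> 0)
      (filtercomap cmod (at_left 1))"
  have "bloch_linear (volterra_op g)"
    using assms(2) by (simp add: bloch_bounded_def)
  then show "\<forall>\<phi>\<in>disk_selfmaps. bloch_compact (commutator g \<phi>)"
    by (intro ballI little_o_imp_commutator_compact[OF assms(1) _ lo])
qed

end
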